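(* In the setting of the context, let $a\in\mathbb{R}^k$ and let $u=(\lambda,x)\in (h\circ\pi')^{-1}(a)\subset E$. Then the tangent space of $(h\circ\pi')^{-1}(a)$ at $u$ is a complement in $T_uE$ of the tangent space of the fiber $E_\lambda$ at $x$, i.e. $$T_uE = T_u\big((h\circ\pi')^{-1}(a)\big)\oplus T_xE_\lambda ,$$ where $T_xE_\lambda$ is identified with $T_u(\pi^{-1}(\lambda))\subset T_uE$.
   Context: Setting. Let $n,m,k>0$ be integers. $\Lambda\subset\mathbb{R}^m$ is a connected open set. $V\subset\mathbb{R}^n$ is a compact submanifold of codimension zero whose boundary $\partial V$ is a stratified manifold. $M=\Lambda\times V$, and $f:M\to\mathbb{R}^n$ is a real analytic map, regarded as a family of vector fields $f(\lambda,\cdot)$ on $V$ defining the systems $\dot x=f(\lambda,x)$. The system stays inside $V$: on $\partial V$ the vector field either points inward or is tangent to $\partial V$. There are $k$ smooth functions $h_1,\dots,h_k:\mathbb{R}^n\to\mathbb{R}$, not depending on $\lambda$, which are first integrals (for each $\lambda\in\Lambda$ each $h_l$ is constant along every solution $x(t)$ in $V$ of $\dot x=f(\lambda,x)$) and are independent, i.e. their gradients $\nabla h_1,\dots,\nabla h_k$ are linearly independent at every point. The equilibrium locus is $E=\{(\lambda,x)\in M: f(\lambda,x)=0\}$, assumed nonempty; it is a smooth real analytic variety of dimension $m+k$. Non-degeneracy conditions (assumed). i) The rank of the matrix $\frac{\partial f}{\partial\lambda}$ is constant equal to $\min(m,n-k)$. ii) The rank of the matrix $\frac{\partial f}{\partial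 x}$ is constant equal to $n-k$ for $(\lambda,x)\in E$, and equals $n-p(\lambda,x)$ at points $(\lambda,x)\notin E$, where $p(\lambda,x)\le k$. iii) For every $(\lambda,x)\in E$, $\ker\left(\frac{\partial f}{\partial x}(\lambda,x)\right)\oplus\operatorname{im}\left(\frac{\partial f}{\partial x}(\lambda,x)\right)=\mathbb{R}^n$. Let $\pi:E\to\Lambda$, $\pi(\lambda,x)=\lambda$, assumed surjective. The fiber $E_\lambda=\pi^{-1}(\lambda)$ is identified with $\{x\in V: f(\lambda,x)=0\}$. Let $\pi':E\to\mathbb{R}^n$, $\pi'(\lambda,x)=x$, and $h=(h_1,\dots,h_k):\mathbb{R}^n\to\mathbb{R}^k$. The map $h\circ\pi'$ is a submersion on $E$, so each nonempty $(h\circ\pi')^{-1}(a)$ is a submanifold of $E$ of dimension $m$.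
   Formalization: When x lies on ∂V, it is additionally assumed that the fiber E_λ is at x a k-dimensional submanifold (possibly with piecewise smooth boundary), and the level set likewise of dimension m; otherwise a fiber can degenerate to a point on ∂V and the claim fails. *)

theory Defs
  imports "HOL-Analysis.Analysis"
begin

section \<open>Smooth and real analytic maps\<close>

text \<open>
  \<open>Ck_on r S f\<close> is meant for open \<open>S\<close>: all iterated directional derivatives of \<open>f\<close> up to order
  \<open>r\<close> exist and are continuous on \<open>S\<close>.
\<close>

primrec Ck_on ::
  "nat \<Rightarrow> 'a::euclidean_space set \<Rightarrow> ('a \<Rightarrow> 'b::euclidean_space) \<Rightarrow> bool" where
  "Ck_on 0 = (\<lambda>S f. continuous_on S f)"
| "Ck_on (Suc r) = (\<lambda>S f. (\<forall>x\<in>S. f differentiable at x) \<and>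
      (\<forall>v. Ck_on r S (\<lambda>x. frechet_derivative f (at x) v)))"

definition smooth_on :: "'a::euclidean_space set \<Rightarrow> ('a \<Rightarrow> 'b::euclidean_space) \<Rightarrow> bool" where
  "smooth_on S f \<longleftrightarrow> (\<forall>r. Ck_on r S f)"

text \<open>
  Analyticity at a point: on a full neighbourhood, \<open>f\<close> is the sum of a (multi-indexed) power
  series. Requiring this at all points of a set that is not open says that \<open>f\<close> is analytic on an
  open neighbourhood of it, the usual convention.
\<close>

definition real_analytic_at ::
  "('a::euclidean_space \<Rightarrow> 'b::euclidean_space) \<Rightarrow> 'a \<Rightarrow> bool" where
  "real_analytic_at f p \<longleftrightarrow> (\<exists>c. \<exists>r>0. \<forall>x\<in>ball p r.
     ((\<lambda>\<alpha>::'a \<Rightarrow> nat. (\<Prod>i\<in>Basis. ((x - p) \<bullet> i) ^ \<alpha> i) *\<^sub>R c \<alpha>) has_sum f x)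
       {\<alpha>. \<forall>i. i \<notin> Basis \<longrightarrow> \<alpha> i = 0})"

section \<open>Submanifolds of Euclidean space\<close>

definition smooth_chart :: "'a::euclidean_space set \<Rightarrow> ('a \<Rightarrow> 'a) \<Rightarrow> bool" where
  "smooth_chart W \<Phi> \<longleftrightarrow> open W \<and> smooth_on W \<Phi> \<and> inj_on \<Phi> W \<and> open (\<Phi> ` W)
     \<and> smooth_on (\<Phi> ` W) (inv_into W \<Phi>)"

definition submanifold :: "nat \<Rightarrow> 'a::euclidean_space set \<Rightarrow> bool" where
  "submanifold d S \<longleftrightarrow> (\<forall>u\<in>S. \<exists>W \<Phi> L. u \<in> W \<and> smooth_chart W \<Phi> \<and> subspace L \<and> dim L = d
     \<and> \<Phi> ` (S \<inter> W) = \<Phi> ` W \<inter> L)"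

text \<open>
  \<open>S\<close> is near \<open>u\<close> a \<open>d\<close>-dimensional submanifold, possibly with boundary. The boundary may be
  piecewise smooth, since it typically comes from intersecting with a region such as a polytope:
  the local models are finite unions of \<open>d\<close>-dimensional closed convex subsets of a
  \<open>d\<close>-dimensional space \<open>L\<close>. This includes \<open>L\<close> itself (no boundary), half-spaces, orthants,
  and convex or re-entrant polyhedral corners; it excludes cusps.
\<close>

definition bd_submanifold_at :: "nat \<Rightarrow> 'a::euclidean_space set \<Rightarrow> 'a \<Rightarrow> bool" where
  "bd_submanifold_at d S u \<longleftrightarrow> u \<in> S \<and> (\<exists>W \<Phi> L \<D>. u \<in> W \<and> smooth_chart W \<Phi>
     \<and> subspace L \<and> dim L = d
     \<and> finite \<D> \<and> (\<forall>D\<in>\<D>. convex D \<and> closed D \<and> D \<subseteq> L \<and> aff_dim D = int d)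
     \<and> \<Phi> ` (S \<inter> W) = \<Phi> ` W \<inter> \<Union>\<D>)"

definition stratified_manifold :: "'a::euclidean_space set \<Rightarrow> bool" where
  "stratified_manifold X \<longleftrightarrow> (\<exists>\<S>. finite \<S> \<and> \<Union>\<S> = X \<and> disjoint \<S>
     \<and> (\<forall>S\<in>\<S>. \<exists>d. submanifold d S)
     \<and> (\<forall>S\<in>\<S>. \<forall>T\<in>\<S>. S \<inter> closure T \<noteq> {} \<longrightarrow> S \<subseteq> closure T))"

text \<open>
  Codimension zero: modelled on open subsets of a half-space of the ambient dimension. By invariance
  of domain the manifold boundary is then the topological frontier. Charts are only topological,
  so that corners are allowed.
\<close>

definition codim0_submanifold :: "'a::euclidean_space set \<Rightarrow> bool" where
  "codim0_submanifold V \<longleftrightarrow> (\<forall>p\<in>V. \<exists>U W. \<exists>b\<in>Basis::'a set.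
     openin (top_of_set V) U \<and> p \<in> U \<and> openin (top_of_set {y::'a. 0 \<le> y \<bullet> b}) W
     \<and> U homeomorphic W)"

section \<open>Tangent vectors\<close>

text \<open>
  The (Bouligand) contingent cone. At a smooth boundary point of a region it consists of the vectors
  that point inward or are tangent to the boundary; it also makes sense at corners.
\<close>

definition contingent_cone :: "'a::euclidean_space set \<Rightarrow> 'a \<Rightarrow> 'a set" where
  "contingent_cone S x = {v. \<exists>(t::nat \<Rightarrow> real) y. (\<forall>j. t j > 0) \<and> t \<longlonglongrightarrow> 0 \<and> y \<longlonglongrightarrow> v
     \<and> (\<forall>j. x + t j *\<^sub>R y j \<in> S)}"

text \<open>
  For a submanifold without boundary the contingent cone is already the space of velocities of
  curves in \<open>S\<close> through \<open>x\<close>. At a boundary point the velocities of curves starting at \<open>x\<close> only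
  form a cone, and the tangent space is its span, as usual for manifolds with boundary.
\<close>

definition tangent_space :: "'a::euclidean_space set \<Rightarrow> 'a \<Rightarrow> 'a set" where
  "tangent_space S x = span (contingent_cone S x)"

definition is_direct_sum :: "'a::real_vector set \<Rightarrow> 'a set \<Rightarrow> 'a set \<Rightarrow> bool" where
  "is_direct_sum T A B \<longleftrightarrow> subspace A \<and> subspace B \<and> A \<inter> B = {0}
     \<and> T = {a + b | a b. a \<in> A \<and> b \<in> B}"

section \<open>Families of vector fields, first integrals, equilibria\<close>

definition is_solution_in ::
  "'a::real_normed_vector set \<Rightarrow> ('a \<Rightarrow> 'a) \<Rightarrow> real set \<Rightarrow> (real \<Rightarrow> 'a) \<Rightarrow> bool" where
  "is_solution_in V F T x \<longleftrightarrow> is_interval T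
     \<and> (\<forall>t\<in>T. x t \<in> V \<and> (x has_vector_derivative F (x t)) (at t within T))"

definition first_integral_on ::
  "'a::real_normed_vector set \<Rightarrow> ('a \<Rightarrow> 'a) \<Rightarrow> ('a \<Rightarrow> real) \<Rightarrow> bool" where
  "first_integral_on V F g \<longleftrightarrow>
     (\<forall>T x. is_solution_in V F T x \<longrightarrow> (\<forall>s\<in>T. \<forall>t\<in>T. g (x s) = g (x t)))"

text \<open>Row \<open>l\<close> of the Jacobian matrix of \<open>h\<close> is the gradient of the component \<open>h\<^sub>l\<close>.\<close>

definition independent_gradients_at :: "(real^'n \<Rightarrow> real^'k) \<Rightarrow> real^'n \<Rightarrow> bool" where
  "independent_gradients_at h x \<longleftrightarrow>
     (\<forall>c::'k \<Rightarrow> real. (\<Sum>l\<in>UNIV. c l *\<^sub>R (jacobian h (at x) $ l)) = 0 \<longrightarrow> (\<forall>l. c l = 0))"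

definition D_par :: "((real^'m) \<times> (real^'n) \<Rightarrow> real^'n) \<Rightarrow> (real^'m) \<times> (real^'n) \<Rightarrow> real^'m^'n" where
  "D_par f u = jacobian (\<lambda>l. f (l, snd u)) (at (fst u))"

definition D_state :: "((real^'m) \<times> (real^'n) \<Rightarrow> real^'n) \<Rightarrow> (real^'m) \<times> (real^'n) \<Rightarrow> real^'n^'n" where
  "D_state f u = jacobian (\<lambda>y. f (fst u, y)) (at (snd u))"

definition equilibria ::
  "(real^'m) set \<Rightarrow> (real^'n) set \<Rightarrow> ((real^'m) \<times> (real^'n) \<Rightarrow> real^'n) \<Rightarrow> ((real^'m) \<times> (real^'n)) set"
  where
  "equilibria \<Lambda> V f = {u \<in> \<Lambda> \<times> V. f u = 0}"

definition fiber ::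
  "(real^'n) set \<Rightarrow> ((real^'m) \<times> (real^'n) \<Rightarrow> real^'n) \<Rightarrow> real^'m \<Rightarrow> (real^'n) set" where
  "fiber V f l = {x \<in> V. f (l, x) = 0}"

definition level_set ::
  "(real^'m) set \<Rightarrow> (real^'n) set \<Rightarrow> ((real^'m) \<times> (real^'n) \<Rightarrow> real^'n) \<Rightarrow> (real^'n \<Rightarrow> real^'k)
     \<Rightarrow> real^'k \<Rightarrow> ((real^'m) \<times> (real^'n)) set" where
  "level_set \<Lambda> V f h a = {u \<in> equilibria \<Lambda> V f. h (snd u) = a}"

end

theory Submission
  imports Defs
begin

text \<open>
  Write \<open>A\<close> for the state derivative of \<open>f\<close> at the equilibrium \<open>u = (\<lambda>, x)\<close>, \<open>F'\<close> for its total derivative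
  there, and \<open>H\<close> for the derivative of \<open>h\<close> at \<open>x\<close>. The three tangent spaces turn out to be the
  kernels
  \<^item> \<open>T E = {v. F' v = 0}\<close>,
  \<^item> \<open>T (level set) = {v. F' v = 0 \<and> H (snd v) = 0}\<close>,
  \<^item> \<open>T (fiber) = ker A\<close>.

  After that the claim is linear algebra. The link between \<open>f\<close> and \<open>h\<close> is the identity \<open>H \<circ> F' = 0\<close>: a
  first integral satisfies \<open>Dh(y) f(\<lambda>, y) = 0\<close>, and where \<open>f\<close> vanishes the derivative of this
  identity loses the term with the second derivative of \<open>h\<close>. Hence \<open>im A\<close> lies in \<open>ker H\<close>. Together with
  \<open>\<real>\<^sup>n = ker A \<oplus> im A\<close>, surjectivity of \<open>H\<close> and the rank of \<open>A\<close> this makes \<open>H\<close> an isomorphism from \<open>ker A\<close>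
  onto \<open>\<real>\<^sup>k\<close>. So no nonzero vector of \<open>ker A\<close> is tangent to a level set of \<open>h\<close>, and the
  \<open>ker A\<close> part of the state component splits off from every vector in the kernel of \<open>F'\<close>
  (\<open>is_direct_sum_kernel\<close>).

  Two points about the identity \<open>H \<circ> F' = 0\<close> need care. To see that \<open>Dh(y) f(\<lambda>, y) = 0\<close> one needs
  solutions, so the proof contains the local existence theorem of Picard and Lindelof
  (\<open>lipschitz_vector_field_has_local_solution\<close>); it is applied in the interior of the region \<open>V\<close> only,
  where no solution can leave \<open>V\<close> at once. If \<open>x\<close> is on the frontier, \<open>V\<close> may be
  too thin at \<open>x\<close> (a cusp, say) to differentiate the identity at \<open>x\<close> itself. Instead difference
  quotients between interior points that converge to \<open>x\<close> are used
  (\<open>annihilator_kills_derivative_at_zero\<close>). This needs a derivative of \<open>f\<close> at \<open>u\<close> that controls increments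
  between arbitrary nearby points, and a convergent power series provides it
  (\<open>real_analytic_at_imp_strictly_differentiable\<close>).

  That the tangent spaces lie in the kernels is immediate from differentiability. The converse
  for \<open>E\<close>, and for the other two sets at frontier points, is a dimension count: a local
  model of dimension \<open>d\<close> yields a tangent space of dimension at least \<open>d\<close>
  (\<open>dim_tangent_space_ge\<close>). At interior points the fiber and the level set have to be shown to be
  large enough: near \<open>u\<close> the equation \<open>f = 0\<close> is equivalent to \<open>A (f) = 0\<close>, because a value of \<open>f\<close> in \<open>ker A\<close> is
  killed by \<open>Dh(y)\<close> too, and \<open>Dh(y)\<close> is still injective on \<open>ker A\<close>. As an equation in \<open>im A\<close>,
  \<open>A (f) = 0\<close> is regular, alone for the fiber and jointly with \<open>h = a\<close> for the level set, so an implicit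
  function argument applies (\<open>kernel_subset_contingent_cone_zero_set\<close>).
\<close>

section \<open>Real analytic maps are strictly differentiable\<close>

text \<open>
  This is the strict (or strong) derivative: increments between any two points near \<open>p\<close>, not only
  increments from \<open>p\<close>, are controlled. It therefore carries local Lipschitz continuity and can be
  used along pairs of points that both move towards \<open>p\<close>.
\<close>

definition strictly_differentiable ::
  "('a::real_normed_vector \<Rightarrow> 'b::real_normed_vector) \<Rightarrow> ('a \<Rightarrow> 'b) \<Rightarrow> 'a \<Rightarrow> bool" where
  "strictly_differentiable f f' p \<longleftrightarrow> bounded_linear f' \<and>
     (\<forall>e>0. \<exists>d>0. \<forall>y\<in>ball p d. \<forall>z\<in>ball p d. norm (f y - f z - f' (y - z)) \<le> e * norm (y - z))"

lemma strictly_differentiable_imp_has_derivative: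
  assumes "strictly_differentiable f f' p"
  shows "(f has_derivative f') (at p)"
  unfolding has_derivative_within_alt
proof (intro conjI allI impI)
  show "bounded_linear f'"
    using assms by (simp add: strictly_differentiable_def)
  fix e :: real assume "e > 0"
  then obtain d where "d > 0"
    and d: "\<And>y z. y \<in> ball p d \<Longrightarrow> z \<in> ball p d \<Longrightarrow> norm (f y - f z - f' (y - z)) \<le> e * norm (y - z)"
    using assms unfolding strictly_differentiable_def by blast
  show "\<exists>d>0. \<forall>y\<in>UNIV. norm (y - p) < d \<longrightarrow> norm (f y - f p - f' (y - p)) \<le> e * norm (y - p)"
    using d[of _ p] \<open>d > 0\<close> by (intro exI[of _ d]) (auto simp: dist_norm norm_minus_commute)
qed

lemma strictly_differentiable_imp_lipschitz:
  assumes "strictly_differentiable f f' p"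
  obtains L d where "d > 0" "L-lipschitz_on (ball p d) f"
proof -
  obtain K where K: "K > 0" "\<And>v. norm (f' v) \<le> norm v * K"
    using assms bounded_linear.pos_bounded unfolding strictly_differentiable_def by blast
  obtain d where "d > 0"
    and d: "\<And>y z. y \<in> ball p d \<Longrightarrow> z \<in> ball p d \<Longrightarrow> norm (f y - f z - f' (y - z)) \<le> 1 * norm (y - z)"
    using assms unfolding strictly_differentiable_def by (meson zero_less_one)
  have "(K + 1)-lipschitz_on (ball p d) f"
  proof (rule lipschitz_onI)
    fix y z assume "y \<in> ball p d" "z \<in> ball p d"
    from d[OF this] K(2)[of "y - z"] norm_triangle_sub[of "f y - f z" "f' (y - z)"]
    show "dist (f y) (f z) \<le> (K + 1) * dist y z"
      by (simp add: dist_norm algebra_simps)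
  qed (use K in auto)
  with \<open>d > 0\<close> show thesis using that by blast
qed

text \<open>
  On the ball of radius \<open>\<theta> s\<close> a monomial of degree at least two is Lipschitz with a constant of order
  \<open>\<theta>\<close>, relative to its size \<open>s\<close> to the power of the degree at the corner \<open>(s, \<dots>, s)\<close> of a cube. The
  factor \<open>\<theta>\<close> is what makes the nonlinear part of a power series negligible; the exponents that appear as
  Lipschitz constants are absorbed by \<open>\<theta> \<le> 1/2\<close>.
\<close>

lemma monomial_diff_bound:
  fixes z w :: "'a::euclidean_space" and \<alpha> :: "'a \<Rightarrow> nat"
  assumes "s > 0" and \<theta>: "0 < \<theta>" "\<theta> \<le> 1/2"
    and z: "norm z \<le> \<theta> * s" and w: "norm w \<le> \<theta> * s"
    and deg: "2 \<le> (\<Sum>i\<in>Basis. \<alpha> i)"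
  shows "\<bar>(\<Prod>i\<in>Basis. (z \<bullet> i) ^ \<alpha> i) - (\<Prod>i\<in>Basis. (w \<bullet> i) ^ \<alpha> i)\<bar>
         \<le> (4 * \<theta> / s) * s ^ (\<Sum>i\<in>Basis. \<alpha> i) * norm (z - w)"
proof -
  define \<rho> where "\<rho> = \<theta> * s"
  have \<rho>: "\<rho> > 0" using assms by (simp add: \<rho>_def)
  obtain m where m: "(\<Sum>i\<in>Basis. \<alpha> i) = m + 2"
    using deg by (metis le_add_diff_inverse2)
  \<comment> \<open>Rescaling by \<open>\<rho>\<close> moves all coordinates into \<open>[-1, 1]\<close>, where powers are Lipschitz with
    constant equal to the exponent.\<close>
  have scale: "(\<Prod>i\<in>Basis. (y \<bullet> i) ^ \<alpha> i) = \<rho> ^ (m + 2) * (\<Prod>i\<in>Basis. (y \<bullet> i / \<rho>) ^ \<alpha> i)"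
    for y :: 'a
  proof -
    have "\<rho> ^ (m + 2) = (\<Prod>i\<in>(Basis::'a set). \<rho> ^ \<alpha> i)" by (simp only: m[symmetric] power_sum)
    then have "\<rho> ^ (m + 2) * (\<Prod>i\<in>Basis. (y \<bullet> i / \<rho>) ^ \<alpha> i)
        = (\<Prod>i\<in>Basis. (\<rho> * (y \<bullet> i / \<rho>)) ^ \<alpha> i)"
      by (simp only: prod.distrib[symmetric] power_mult_distrib)
    then show ?thesis using \<rho> by simp
  qed
  have small: "\<bar>y \<bullet> i / \<rho>\<bar> \<le> 1" if "norm y \<le> \<theta> * s" "i \<in> Basis" for y i :: 'a
    using Basis_le_norm[OF that(2), of y] that(1) \<rho> by (simp add: \<rho>_def divide_le_eq_1)
  have "\<bar>(\<Prod>i\<in>Basis. (z \<bullet> i / \<rho>) ^ \<alpha> i) - (\<Prod>i\<in>Basis. (w \<bullet> i / \<rho>) ^ \<alpha> i)\<bar>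
        \<le> (\<Sum>i\<in>Basis. \<bar>(z \<bullet> i / \<rho>) ^ \<alpha> i - (w \<bullet> i / \<rho>) ^ \<alpha> i\<bar>)"
    using norm_prod_diff[of Basis "\<lambda>i. (z \<bullet> i / \<rho>) ^ \<alpha> i" "\<lambda>i. (w \<bullet> i / \<rho>) ^ \<alpha> i"]
      small[OF z] small[OF w] by (auto simp: power_abs power_le_one)
  also have "\<dots> \<le> (\<Sum>i\<in>Basis. real (\<alpha> i) * (norm (z - w) / \<rho>))"
  proof (rule sum_mono)
    fix i :: 'a assume i: "i \<in> Basis"
    have "\<bar>(z \<bullet> i / \<rho>) ^ \<alpha> i - (w \<bullet> i / \<rho>) ^ \<alpha> i\<bar> \<le> real (\<alpha> i) * \<bar>z \<bullet> i / \<rho> - w \<bullet> i / \<rho>\<bar>"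
      using norm_power_diff[of "z \<bullet> i / \<rho>" "w \<bullet> i / \<rho>" "\<alpha> i"] small[OF z i] small[OF w i] by simp
    also have "\<bar>z \<bullet> i / \<rho> - w \<bullet> i / \<rho>\<bar> \<le> norm (z - w) / \<rho>"
      using Basis_le_norm[OF i, of "z - w"] \<rho>
      by (simp add: inner_diff_left divide_right_mono flip: diff_divide_distrib)
    finally show "\<bar>(z \<bullet> i / \<rho>) ^ \<alpha> i - (w \<bullet> i / \<rho>) ^ \<alpha> i\<bar> \<le> real (\<alpha> i) * (norm (z - w) / \<rho>)"
      by (simp add: mult_left_mono)
  qed
  also have "\<dots> = real (m + 2) * (norm (z - w) / \<rho>)"
    by (simp only: m[symmetric] of_nat_sum sum_distrib_right)
  finally have "\<rho> ^ (m + 2) * \<bar>(\<Prod>i\<in>Basis. (z \<bullet> i / \<rho>) ^ \<alpha> i) - (\<Prod>i\<in>Basis. (w \<bullet> i / \<rho>) ^ \<alpha> i)\<bar>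
      \<le> \<rho> ^ (m + 2) * (real (m + 2) * (norm (z - w) / \<rho>))"
    using \<rho> by (intro mult_left_mono) auto
  moreover have "(\<Prod>i\<in>Basis. (z \<bullet> i) ^ \<alpha> i) - (\<Prod>i\<in>Basis. (w \<bullet> i) ^ \<alpha> i)
      = \<rho> ^ (m + 2) * ((\<Prod>i\<in>Basis. (z \<bullet> i / \<rho>) ^ \<alpha> i) - (\<Prod>i\<in>Basis. (w \<bullet> i / \<rho>) ^ \<alpha> i))"
    by (simp only: scale[of z] scale[of w] right_diff_distrib)
  ultimately have "\<bar>(\<Prod>i\<in>Basis. (z \<bullet> i) ^ \<alpha> i) - (\<Prod>i\<in>Basis. (w \<bullet> i) ^ \<alpha> i)\<bar>
      \<le> \<rho> ^ (m + 2) * (real (m + 2) * (norm (z - w) / \<rho>))"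
    by (simp only: abs_mult power_abs abs_of_pos[OF \<rho>])
  also have "\<dots> = (\<theta> ^ m * real (m + 2)) * (\<theta> * s ^ (m + 1) * norm (z - w))"
    using \<open>s > 0\<close> \<theta> by (simp add: \<rho>_def power_mult_distrib field_simps)
  also have "\<dots> \<le> 4 * (\<theta> * s ^ (m + 1) * norm (z - w))"
  proof (rule mult_right_mono)
    have "\<theta> ^ m * real (m + 2) \<le> (1/2) ^ m * (4 * 2 ^ m)"
    proof (rule mult_mono)
      show "\<theta> ^ m \<le> (1/2) ^ m" using \<theta> by (intro power_mono) auto
      have "real m < 2 ^ m" using of_nat_less_two_power by blast
      moreover have "(1::real) \<le> 2 ^ m" by simp
      ultimately show "real (m + 2) \<le> 4 * 2 ^ m" by linarith
    qed auto
    then show "\<theta> ^ m * real (m + 2) \<le> 4" by (simp add: power_divide)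
  qed (use \<open>s > 0\<close> \<theta> in auto)
  also have "\<dots> = (4 * \<theta> / s) * s ^ (m + 2) * norm (z - w)"
    using \<open>s > 0\<close> by (simp add: field_simps)
  finally show ?thesis by (simp only: m)
qed

lemma summable_on_imp_abs_summable_on_euclidean:
  fixes g :: "'i \<Rightarrow> 'b::euclidean_space"
  assumes "g summable_on A"
  shows "(\<lambda>x. norm (g x)) summable_on A"
proof -
  have "(\<lambda>x. \<Sum>b\<in>B. \<bar>g x \<bullet> b\<bar>) summable_on A" if "finite B" for B
    using that
  proof (induction B)
    case (insert b B)
    have "(\<lambda>x. g x \<bullet> b) summable_on A"
      using summable_on_bounded_linear[OF bounded_linear_inner_left assms] .
    then have "(\<lambda>x. \<bar>g x \<bullet> b\<bar>) summable_on A"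
      using summable_on_iff_abs_summable_on_real by force
    then show ?case
      using insert by (simp add: summable_on_add)
  qed simp
  from this[OF finite_Basis] show ?thesis
    by (rule summable_on_comparison_test) (auto intro: norm_le_l1)
qed

lemma has_sum_diff:
  fixes f g :: "'i \<Rightarrow> 'b::real_normed_vector"
  assumes "(f has_sum a) A" "(g has_sum b) A"
  shows "((\<lambda>x. f x - g x) has_sum (a - b)) A"
  using has_sum_add[OF assms(1), of "\<lambda>x. - g x" "- b"] assms(2) by (simp add: has_sum_uminus)

text \<open>
  The candidate derivative \<open>f'\<close> is the degree one part of the series. In \<open>f y - f z - f' (y - z)\<close> the
  parts of degree zero and one cancel, and the remaining terms are bounded by
  \<open>monomial_diff_bound\<close>, which is summable because the series converges absolutely at a corner.
\<close>

lemma real_analytic_at_imp_strictly_differentiable: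
  fixes f :: "'a::euclidean_space \<Rightarrow> 'b::euclidean_space"
  assumes "real_analytic_at f p"
  obtains f' where "strictly_differentiable f f' p"
proof -
  define A :: "('a \<Rightarrow> nat) set" where "A = {\<alpha>. \<forall>i. i \<notin> Basis \<longrightarrow> \<alpha> i = 0}"
  define mon :: "('a \<Rightarrow> nat) \<Rightarrow> 'a \<Rightarrow> real" where "mon \<alpha> z = (\<Prod>i\<in>Basis. (z \<bullet> i) ^ \<alpha> i)" for \<alpha> z
  define deg :: "('a \<Rightarrow> nat) \<Rightarrow> nat" where "deg \<alpha> = (\<Sum>i\<in>Basis. \<alpha> i)" for \<alpha>
  obtain c r where "r > 0"
    and series: "\<And>x. x \<in> ball p r \<Longrightarrow> ((\<lambda>\<alpha>. mon \<alpha> (x - p) *\<^sub>R c \<alpha>) has_sum f x) A"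
    using assms unfolding real_analytic_at_def mon_def A_def by blast
  \<comment> \<open>The corner \<open>(s, \<dots>, s)\<close> has norm at most \<open>DIM('a) * s\<close>, so it lies inside the ball of convergence.\<close>
  define s where "s = r / (2 * real DIM('a))"
  have s: "s > 0" using \<open>r > 0\<close> by (simp add: s_def)
  define C where "C = (\<Sum>\<^sub>\<infinity>\<alpha>\<in>A. s ^ deg \<alpha> * norm (c \<alpha>))"
  have C: "((\<lambda>\<alpha>. s ^ deg \<alpha> * norm (c \<alpha>)) has_sum C) A"
  proof -
    \<comment> \<open>At the corner \<open>(s, \<dots>, s)\<close> each monomial takes its maximum \<open>s ^ deg \<alpha>\<close> over a cube, so the
      absolute convergence of the series there bounds it on the whole cube.\<close>
    define q :: 'a where "q = (\<Sum>i\<in>Basis. s *\<^sub>R i)"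
    have "norm q \<le> (\<Sum>i\<in>(Basis::'a set). s)"
      unfolding q_def using s by (intro sum_norm_le) auto
    also have "\<dots> < r" using \<open>r > 0\<close> by (simp add: s_def)
    finally have "((\<lambda>\<alpha>. mon \<alpha> q *\<^sub>R c \<alpha>) has_sum f (p + q)) A"
      using series[of "p + q"] by (simp add: dist_norm)
    moreover have "mon \<alpha> q = s ^ deg \<alpha>" for \<alpha>
      by (simp add: mon_def deg_def q_def power_sum inner_sum_left inner_Basis if_distrib cong: if_cong)
    ultimately have "((\<lambda>\<alpha>. s ^ deg \<alpha> *\<^sub>R c \<alpha>) has_sum f (p + q)) A" by simp
    then have "(\<lambda>\<alpha>. norm (s ^ deg \<alpha> *\<^sub>R c \<alpha>)) summable_on A"
      by (intro summable_on_imp_abs_summable_on_euclidean) (rule has_sum_imp_summable)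
    then have "(\<lambda>\<alpha>. s ^ deg \<alpha> * norm (c \<alpha>)) summable_on A" using s by simp
    then show ?thesis unfolding C_def by (rule has_sum_infsum)
  qed
  have "C \<ge> 0"
    using C by (rule has_sum_nonneg) (use s in auto)
  define e :: "'a \<Rightarrow> 'a \<Rightarrow> nat" where "e b = (\<lambda>i. if i = b then 1 else 0)" for b
  have e_deg: "{\<alpha>\<in>A. deg \<alpha> = 1} = e ` Basis"
  proof (intro equalityI subsetI)
    fix \<alpha> assume "\<alpha> \<in> {\<alpha>\<in>A. deg \<alpha> = 1}"
    then obtain b where "b \<in> Basis" "\<alpha> b = 1" "\<forall>i\<in>Basis. b \<noteq> i \<longrightarrow> \<alpha> i = 0" "\<forall>i. i \<notin> Basis \<longrightarrow> \<alpha> i = 0"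
      using sum_eq_1_iff[OF finite_Basis, of \<alpha>] by (auto simp: deg_def A_def)
    then have "\<alpha> = e b" by (force simp: e_def)
    then show "\<alpha> \<in> e ` Basis" using \<open>b \<in> Basis\<close> by blast
  qed (auto simp: A_def deg_def e_def)
  have mon_e: "mon (e b) z = z \<bullet> b" if "b \<in> Basis" for b z
    using that by (simp add: mon_def e_def if_distrib prod.If_cases cong: if_cong)
  define f' where "f' v = (\<Sum>\<alpha>\<in>e ` Basis. mon \<alpha> v *\<^sub>R c \<alpha>)" for v
  have "linear (\<lambda>v. (v \<bullet> b) *\<^sub>R c (e b))" for b
    by (rule linearI) (auto simp: inner_add_left scaleR_add_left)
  moreover have "linear (\<lambda>v. mon (e b) v *\<^sub>R c (e b)) = linear (\<lambda>v. (v \<bullet> b) *\<^sub>R c (e b))" if "b \<in> Basis" for b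
    using that by (simp add: mon_e)
  ultimately have "linear f'"
    unfolding f'_def by (intro linear_compose_sum) auto
  then have bl: "bounded_linear f'" by (rule linear_conv_bounded_linear[THEN iffD1])
  have f'_sum: "((\<lambda>\<alpha>. if deg \<alpha> = 1 then mon \<alpha> v *\<^sub>R c \<alpha> else 0) has_sum f' v) A" for v
  proof -
    have "((\<lambda>\<alpha>. mon \<alpha> v *\<^sub>R c \<alpha>) has_sum f' v) (e ` Basis)"
      unfolding f'_def by (rule has_sum_finite) simp
    then show ?thesis
      by (rule has_sum_cong_neutral[THEN iffD1, rotated 3]) (use e_deg in auto)
  qed
  have main: "norm (f y - f z - f' (y - z)) \<le> 4 * \<theta> / s * C * norm (y - z)"
    if \<theta>: "0 < \<theta>" "\<theta> \<le> 1/2" and y: "y \<in> ball p (\<theta> * s)" and z: "z \<in> ball p (\<theta> * s)" for \<theta> y z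
  proof -
    have "real DIM('a) \<ge> 1" by (simp add: Suc_leI)
    then have "1 \<le> 2 * real DIM('a)" by linarith
    then have "r * 1 \<le> r * (2 * real DIM('a))" using \<open>r > 0\<close> by (intro mult_left_mono) auto
    then have "s \<le> r" using \<open>1 \<le> 2 * real DIM('a)\<close> unfolding s_def by (subst pos_divide_le_eq) auto
    have "\<theta> * s \<le> 1 * s" using \<theta> s by (intro mult_right_mono) auto
    with \<open>s \<le> r\<close> have "\<theta> * s \<le> r" by simp
    then have "y \<in> ball p r" "z \<in> ball p r" using y z by auto
    note series[OF this(1)] series[OF this(2)]
    then have sum1: "((\<lambda>\<alpha>. mon \<alpha> (y - p) *\<^sub>R c \<alpha> - mon \<alpha> (z - p) *\<^sub>R c \<alpha>
        - (if deg \<alpha> = 1 then mon \<alpha> (y - z) *\<^sub>R c \<alpha> else 0)) has_sum (f y - f z - f' (y - z))) A"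
      by (intro has_sum_diff f'_sum)
    show ?thesis
    proof (rule norm_infsum_le[OF sum1])
      show "((\<lambda>\<alpha>. 4 * \<theta> / s * (s ^ deg \<alpha> * norm (c \<alpha>)) * norm (y - z)) has_sum
          4 * \<theta> / s * C * norm (y - z)) A"
        by (intro has_sum_cmult_left has_sum_cmult_right C)
      fix \<alpha> assume "\<alpha> \<in> A"
      consider "deg \<alpha> = 0" | "deg \<alpha> = 1" | "deg \<alpha> \<ge> 2" by linarith
      then show "norm (mon \<alpha> (y - p) *\<^sub>R c \<alpha> - mon \<alpha> (z - p) *\<^sub>R c \<alpha>
          - (if deg \<alpha> = 1 then mon \<alpha> (y - z) *\<^sub>R c \<alpha> else 0))
        \<le> 4 * \<theta> / s * (s ^ deg \<alpha> * norm (c \<alpha>)) * norm (y - z)"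
      proof cases
        case 1
        then have "mon \<alpha> v = 1" for v by (simp add: mon_def deg_def)
        then show ?thesis using 1 s \<theta> by simp
      next
        case 2
        then obtain b where "b \<in> Basis" "\<alpha> = e b" using e_deg \<open>\<alpha> \<in> A\<close> by blast
        then have "mon \<alpha> (y - p) *\<^sub>R c \<alpha> - mon \<alpha> (z - p) *\<^sub>R c \<alpha> - mon \<alpha> (y - z) *\<^sub>R c \<alpha> = 0"
          by (simp add: mon_e inner_diff_left flip: scaleR_diff_left)
        then show ?thesis using 2 s \<theta> by simp
      next
        case 3
        have "\<bar>mon \<alpha> (y - p) - mon \<alpha> (z - p)\<bar> \<le> (4 * \<theta> / s) * s ^ deg \<alpha> * norm ((y - p) - (z - p))"
          unfolding mon_def deg_def
          by (rule monomial_diff_bound)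
            (use s \<theta> y z 3 in \<open>auto simp: deg_def dist_norm norm_minus_commute\<close>)
        then have "\<bar>mon \<alpha> (y - p) - mon \<alpha> (z - p)\<bar> * norm (c \<alpha>)
            \<le> (4 * \<theta> / s) * s ^ deg \<alpha> * norm (y - z) * norm (c \<alpha>)"
          by (intro mult_right_mono) auto
        then show ?thesis using 3 by (simp add: mult_ac flip: scaleR_diff_left)
      qed
    qed
  qed
  have "strictly_differentiable f f' p"
    unfolding strictly_differentiable_def
  proof (intro conjI bl allI impI)
    fix \<epsilon> :: real assume "\<epsilon> > 0"
    define \<theta> where "\<theta> = min (1/2) (\<epsilon> * s / (4 * (C + 1)))"
    have \<theta>: "0 < \<theta>" "\<theta> \<le> 1/2"
      unfolding \<theta>_def by (simp_all only: min.cobounded1) (use \<open>\<epsilon> > 0\<close> s \<open>C \<ge> 0\<close> in simp)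
    have "\<theta> \<le> \<epsilon> * s / (4 * (C + 1))" by (simp add: \<theta>_def)
    then have "4 * \<theta> * (C + 1) \<le> \<epsilon> * s" using \<open>C \<ge> 0\<close> by (simp add: field_simps)
    moreover have "4 * \<theta> * C \<le> 4 * \<theta> * (C + 1)" using \<theta> by simp
    ultimately have "4 * \<theta> / s * C \<le> \<epsilon>" using s by (simp add: field_simps)
    then have "norm (f y - f z - f' (y - z)) \<le> \<epsilon> * norm (y - z)"
      if "y \<in> ball p (\<theta> * s)" "z \<in> ball p (\<theta> * s)" for y z
      using main[OF \<theta> that] by (meson mult_right_mono norm_ge_zero order_trans)
    then show "\<exists>d>0. \<forall>y\<in>ball p d. \<forall>z\<in>ball p d. norm (f y - f z - f' (y - z)) \<le> \<epsilon> * norm (y - z)"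
      using \<theta> s by (intro exI[of _ "\<theta> * s"]) auto
  qed
  then show thesis using that by blast
qed

section \<open>First integrals annihilate the vector field\<close>

text \<open>
  Picard iteration. To obtain a contraction of a whole Banach space, the field is first extended from
  the ball to a bounded Lipschitz field \<open>G\<close> by composing with the nearest point projection, and
  time is clamped to \<open>[0, \<tau>]\<close>. For small \<open>\<tau>\<close> the fixed point cannot leave the ball, so there
  it solves the original equation.
\<close>

lemma lipschitz_vector_field_has_local_solution:
  fixes F :: "'a::euclidean_space \<Rightarrow> 'a"
  assumes "r > 0" and lip: "L-lipschitz_on (cball x r) F"
  obtains \<tau> \<phi> where "\<tau> > 0" "\<phi> 0 = x" "is_solution_in (cball x r) F {0..\<tau>} \<phi>"
proof -
  have "L \<ge> 0" using lip by (rule lipschitz_on_nonneg)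
  define G where "G = (\<lambda>y. F (closest_point (cball x r) y))"
  have cp: "closest_point (cball x r) y \<in> cball x r" for y
    using \<open>r > 0\<close> by (intro closest_point_in_set) auto
  have G_lip: "norm (G y - G z) \<le> L * dist y z" for y z
  proof -
    have "dist (G y) (G z) \<le> L * dist (closest_point (cball x r) y) (closest_point (cball x r) z)"
      unfolding G_def by (rule lipschitz_onD[OF lip cp cp])
    also have "\<dots> \<le> L * dist y z"
      using \<open>L \<ge> 0\<close> \<open>r > 0\<close> by (intro mult_left_mono closest_point_lipschitz) auto
    finally show ?thesis by (simp add: dist_norm)
  qed
  have G_cont: "continuous_on S G" for S
  proof -
    have "L-lipschitz_on UNIV G" using G_lip \<open>L \<ge> 0\<close> by (intro lipschitz_onI) (auto simp: dist_norm)
    then show ?thesis by (meson lipschitz_on_continuous_on continuous_on_subset subset_UNIV)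
  qed
  define M where "M = norm (F x) + L * r"
  have "M \<ge> 0" using \<open>L \<ge> 0\<close> \<open>r > 0\<close> by (simp add: M_def)
  have G_bound: "norm (G y) \<le> M" for y
  proof -
    have "dist (F (closest_point (cball x r) y)) (F x) \<le> L * dist (closest_point (cball x r) y) x"
      using lip cp \<open>r > 0\<close> by (intro lipschitz_onD) auto
    also have "\<dots> \<le> L * r"
      using cp[of y] \<open>L \<ge> 0\<close> by (intro mult_left_mono) (auto simp: dist_commute)
    finally show ?thesis
      unfolding G_def M_def dist_norm using norm_triangle_sub[of "F (closest_point (cball x r) y)" "F x"] by linarith
  qed
  \<comment> \<open>The first bound makes the Picard operator a contraction, the second keeps its values in the ball.\<close>
  define \<tau> where "\<tau> = min (1 / (2 * (L + 1))) (r / (M + 1))"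
  have "\<tau> > 0" using \<open>L \<ge> 0\<close> \<open>M \<ge> 0\<close> \<open>r > 0\<close> by (simp add: \<tau>_def)
  have "\<tau> \<le> 1 / (2 * (L + 1))" by (simp add: \<tau>_def)
  then have "L * \<tau> \<le> 1 / 2"
    using \<open>L \<ge> 0\<close> \<open>\<tau> > 0\<close> by (simp add: field_simps)
  have "\<tau> \<le> r / (M + 1)" by (simp add: \<tau>_def)
  then have "M * \<tau> \<le> r"
    using \<open>M \<ge> 0\<close> \<open>\<tau> > 0\<close> by (simp add: field_simps)
  define cl where "cl t = max 0 (min \<tau> t)" for t
  have cl: "0 \<le> cl t" "cl t \<le> \<tau>" for t using \<open>\<tau> > 0\<close> by (auto simp: cl_def)
  define P where "P \<phi> t = x + integral {0..cl t} (\<lambda>s. G (apply_bcontfun \<phi> s))" for \<phi> :: "real \<Rightarrow>\<^sub>C 'a" and t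
  have int: "(\<lambda>s. G (apply_bcontfun \<phi> s)) integrable_on {a..b}" for \<phi> :: "real \<Rightarrow>\<^sub>C 'a" and a b
    by (intro integrable_continuous_real continuous_on_compose2[OF G_cont[of UNIV]])
       (auto intro: continuous_on_subset[OF continuous_on_apply_bcontfun])
  have P_bcont: "P \<phi> \<in> bcontfun" for \<phi>
  proof -
    have cont: "continuous_on {0..\<tau>} (\<lambda>t. x + integral {0..t} (\<lambda>s. G (apply_bcontfun \<phi> s)))"
      by (intro continuous_intros indefinite_integral_continuous_1 int)
    have "continuous_on UNIV (P \<phi>)"
      unfolding P_def by (rule continuous_on_compose2[OF cont, of _ cl])
         (use cl \<open>\<tau> > 0\<close> in \<open>auto simp: cl_def[abs_def] intro!: continuous_intros\<close>)
    moreover have "range (P \<phi>) \<subseteq> (\<lambda>t. x + integral {0..t} (\<lambda>s. G (apply_bcontfun \<phi> s))) ` {0..\<tau>}"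
      using cl by (auto simp: P_def)
    then have "bounded (range (P \<phi>))"
      using compact_continuous_image[OF cont] by (meson bounded_subset compact_Icc compact_imp_bounded)
    ultimately show ?thesis by (simp add: bcontfun_def)
  qed
  have "\<exists>!\<phi>. Bcontfun (P \<phi>) = \<phi>"
  proof (rule banach_fix_type[of "1/2"])
    show "\<forall>\<phi> \<psi>. dist (Bcontfun (P \<phi>)) (Bcontfun (P \<psi>)) \<le> 1 / 2 * dist \<phi> \<psi>"
    proof (intro allI dist_bound)
      fix \<phi> \<psi> :: "real \<Rightarrow>\<^sub>C 'a" and t :: real
      have "dist (P \<phi> t) (P \<psi> t)
          = norm (integral {0..cl t} (\<lambda>s. G (apply_bcontfun \<phi> s) - G (apply_bcontfun \<psi> s)))"
        by (simp add: P_def dist_norm integral_diff[OF int int])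
      also have "\<dots> \<le> (L * dist \<phi> \<psi>) * measure lborel {0..cl t}"
      proof (rule has_integral_bound_real)
        show "((\<lambda>s. G (apply_bcontfun \<phi> s) - G (apply_bcontfun \<psi> s)) has_integral
          integral {0..cl t} (\<lambda>s. G (apply_bcontfun \<phi> s) - G (apply_bcontfun \<psi> s))) {0..cl t}"
          by (intro integrable_integral integrable_diff int)
        show "norm (G (apply_bcontfun \<phi> s) - G (apply_bcontfun \<psi> s)) \<le> L * dist \<phi> \<psi>" for s
          using G_lip dist_bounded[of \<phi> s \<psi>] \<open>L \<ge> 0\<close> by (meson mult_left_mono order_trans)
      qed (use \<open>L \<ge> 0\<close> in auto)
      also have "\<dots> \<le> (L * dist \<phi> \<psi>) * \<tau>"
        using cl[of t] \<open>L \<ge> 0\<close> by (intro mult_left_mono) auto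
      also have "\<dots> \<le> 1 / 2 * dist \<phi> \<psi>"
        using mult_right_mono[OF \<open>L * \<tau> \<le> 1 / 2\<close>, of "dist \<phi> \<psi>"] by (simp add: mult_ac)
      finally show "dist (apply_bcontfun (Bcontfun (P \<phi>)) t) (apply_bcontfun (Bcontfun (P \<psi>)) t) \<le> 1 / 2 * dist \<phi> \<psi>"
        by (simp add: Bcontfun_inverse P_bcont)
    qed
  qed auto
  then obtain \<phi> where "Bcontfun (P \<phi>) = \<phi>" by blast
  then have \<phi>: "apply_bcontfun \<phi> t = P \<phi> t" for t
    using Bcontfun_inverse[OF P_bcont, of \<phi>] by simp
  have on: "apply_bcontfun \<phi> t = x + integral {0..t} (\<lambda>s. G (apply_bcontfun \<phi> s))" if "t \<in> {0..\<tau>}" for t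
    using that by (subst \<phi>) (simp add: P_def cl_def min_absorb2 max_absorb2)
  have in_ball: "apply_bcontfun \<phi> t \<in> cball x r" if "t \<in> {0..\<tau>}" for t
  proof -
    have "norm (integral {0..t} (\<lambda>s. G (apply_bcontfun \<phi> s))) \<le> M * measure lborel {0..t}"
      by (rule has_integral_bound_real[OF \<open>M \<ge> 0\<close> _ integrable_integral[OF int]]) (use G_bound in auto)
    also have "\<dots> \<le> M * \<tau>" using that \<open>M \<ge> 0\<close> by (intro mult_left_mono) auto
    finally show ?thesis using \<open>M * \<tau> \<le> r\<close> by (simp add: on[OF that] dist_norm)
  qed
  have "(apply_bcontfun \<phi> has_vector_derivative F (apply_bcontfun \<phi> t)) (at t within {0..\<tau>})"
    if t: "t \<in> {0..\<tau>}" for t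
  proof -
    have "((\<lambda>t. x + integral {0..t} (\<lambda>s. G (apply_bcontfun \<phi> s))) has_vector_derivative
        0 + G (apply_bcontfun \<phi> t)) (at t within {0..\<tau>})"
      by (intro has_vector_derivative_add has_vector_derivative_const integral_has_vector_derivative t
          continuous_on_compose2[OF G_cont[of UNIV]])
        (auto intro: continuous_on_subset[OF continuous_on_apply_bcontfun])
    moreover have "G (apply_bcontfun \<phi> t) = F (apply_bcontfun \<phi> t)"
      using in_ball[OF t] by (simp add: G_def closest_point_self)
    ultimately show ?thesis
      by (auto intro: has_vector_derivative_transform[OF t on])
  qed
  then have "is_solution_in (cball x r) F {0..\<tau>} (apply_bcontfun \<phi>)"
    using in_ball by (auto simp: is_solution_in_def is_interval_cc)
  moreover have "apply_bcontfun \<phi> 0 = x" using on[of 0] \<open>\<tau> > 0\<close> by simp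
  ultimately show thesis using that \<open>\<tau> > 0\<close> by blast
qed

lemma first_integral_derivative_vanishes:
  fixes F :: "'a::euclidean_space \<Rightarrow> 'a"
  assumes "x \<in> interior V" and "d > 0" and lip: "L-lipschitz_on (ball x d) F"
    and fi: "first_integral_on V F g" and deriv: "(g has_derivative g') (at x)"
  shows "g' (F x) = 0"
proof -
  obtain \<epsilon> where \<epsilon>: "\<epsilon> > 0" "ball x \<epsilon> \<subseteq> V"
    using assms(1) unfolding mem_interior by blast
  define r where "r = min d \<epsilon> / 2"
  have r: "r > 0" "cball x r \<subseteq> ball x d" "cball x r \<subseteq> V"
    using \<epsilon> \<open>d > 0\<close> by (auto simp: r_def subset_iff)
  from lipschitz_on_subset[OF lip r(2)]
  obtain \<tau> \<phi> where "\<tau> > 0" and \<phi>: "\<phi> 0 = x" "is_solution_in (cball x r) F {0..\<tau>} \<phi>"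
    using lipschitz_vector_field_has_local_solution[OF \<open>r > 0\<close>] by metis
  have "is_solution_in V F {0..\<tau>} \<phi>"
    using \<phi>(2) r(3) unfolding is_solution_in_def by blast
  then have const: "g (\<phi> t) = g x" if "t \<in> {0..\<tau>}" for t
    using fi that \<open>\<tau> > 0\<close> \<phi>(1) unfolding first_integral_on_def
    by (metis atLeastAtMost_iff less_eq_real_def order_refl)
  \<comment> \<open>The solution exists forward in time only; a one-sided derivative at time zero is enough.\<close>
  have "(\<phi> has_derivative (\<lambda>t. t *\<^sub>R F x)) (at 0 within {0..\<tau>})"
    using \<phi>(2)[unfolded is_solution_in_def, THEN conjunct2, rule_format, of 0] \<phi>(1) \<open>\<tau> > 0\<close>
    by (simp add: has_vector_derivative_def)
  then have "((g \<circ> \<phi>) has_derivative (g' \<circ> (\<lambda>t. t *\<^sub>R F x))) (at 0 within {0..\<tau>})"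
    using deriv \<phi>(1) by (intro diff_chain_within) (auto intro: has_derivative_at_withinI)
  then have "((g \<circ> \<phi>) has_vector_derivative g' (F x)) (at 0 within {0..\<tau>})"
    using has_derivative_linear[OF deriv] by (simp add: has_vector_derivative_def o_def linear_scale)
  moreover have "((g \<circ> \<phi>) has_vector_derivative 0) (at 0 within {0..\<tau>})"
    by (rule has_vector_derivative_transform[OF _ _ has_vector_derivative_const[of "g x"]])
       (use \<open>\<tau> > 0\<close> const in auto)
  ultimately show ?thesis
    using \<open>\<tau> > 0\<close> by (intro vector_derivative_unique_within_closed_interval[of 0 \<tau> 0]) auto
qed

section \<open>Differentiating the first integral identity at an equilibrium\<close>

text \<open>
  In a half-space chart the points off the bounding hyperplane are dense, and by invariance of domain
  they are interior points of \<open>V\<close>. So identities that hold in the interior of the region pass to the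
  frontier by continuity.
\<close>

lemma codim0_submanifold_subset_closure_interior:
  fixes V :: "'a::euclidean_space set"
  assumes "codim0_submanifold V"
  shows "V \<subseteq> closure (interior V)"
proof
  fix p assume "p \<in> V"
  then obtain U W b where b: "b \<in> Basis" and U: "openin (top_of_set V) U" "p \<in> U"
    and W: "openin (top_of_set {y::'a. 0 \<le> y \<bullet> b}) W" and "U homeomorphic W"
    using assms unfolding codim0_submanifold_def by blast
  then obtain k l where hom: "homeomorphism U W k l" by (auto simp: homeomorphic_def)
  show "p \<in> closure (interior V)"
    unfolding closure_iff_nhds_not_empty
  proof (intro allI impI)
    fix O' T assume "O' \<subseteq> T" "open O'" "p \<in> O'"
    then have "openin (top_of_set U) (U \<inter> O')" by (simp add: openin_open_Int)
    then have "openin (top_of_set W) (k ` (U \<inter> O'))"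
      by (rule homeomorphism_imp_open_map[OF hom])
    then have "openin (top_of_set {y. 0 \<le> y \<bullet> b}) (k ` (U \<inter> O'))"
      using W openin_trans by blast
    then obtain Q where Q: "open Q" "k ` (U \<inter> O') = {y. 0 \<le> y \<bullet> b} \<inter> Q"
      by (auto simp: openin_open)
    define R where "R = Q \<inter> {y. 0 < y \<bullet> b}"
    have "open R" using Q(1) open_halfspace_gt[of 0 b] by (auto simp: R_def inner_commute)
    have sub: "R \<subseteq> k ` (U \<inter> O')" unfolding Q(2) by (auto simp: R_def)
    also have "\<dots> \<subseteq> W" using hom by (auto simp: homeomorphism_def)
    finally have "R \<subseteq> W" .
    have "inj_on l W" using hom by (metis homeomorphism_def inj_on_inverseI)
    then have "open (l ` R)"
      using \<open>open R\<close> \<open>R \<subseteq> W\<close> hom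
      by (intro invariance_of_domain) (auto simp: homeomorphism_def intro: continuous_on_subset inj_on_subset)
    moreover have lR: "l ` R \<subseteq> U \<inter> O'"
      using sub hom by (force simp: homeomorphism_def)
    moreover have "U \<subseteq> V" using U(1) openin_imp_subset by blast
    ultimately have "l ` R \<subseteq> interior V" by (intro interior_maximal) auto
    moreover have "R \<noteq> {}"
    proof -
      have kp: "k p \<in> Q" "0 \<le> k p \<bullet> b" using Q(2) U(2) \<open>p \<in> O'\<close> by blast+
      then obtain s where s: "s > 0" "ball (k p) s \<subseteq> Q"
        using Q(1) open_contains_ball by blast
      then have "k p + (s/2) *\<^sub>R b \<in> R"
        using b kp(2) by (auto simp: R_def dist_norm inner_add_left intro!: subsetD[OF s(2)])
      then show ?thesis by blast
    qed
    ultimately show "interior V \<inter> T \<noteq> {}" using lR \<open>O' \<subseteq> T\<close> by blast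
  qed
qed

text \<open>
  Formally, differentiating \<open>H y (F y) = 0\<close> gives \<open>H x \<circ> F'\<close> plus a term that contains the factor
  \<open>F x = 0\<close>. The identity is given on an open set that only accumulates at \<open>x\<close>, so the derivative is
  taken along pairs \<open>y n\<close>, \<open>z n = y n + t n *\<^sub>R \<xi>\<close> of points of \<open>U\<close> that converge to \<open>x\<close>.
\<close>

lemma annihilator_kills_derivative_at_zero:
  fixes F :: "'a::real_normed_vector \<Rightarrow> 'b::real_normed_vector"
    and H :: "'a \<Rightarrow> ('b \<Rightarrow>\<^sub>L 'c::real_normed_vector)"
  assumes "open U" "x \<in> closure U" and strict: "strictly_differentiable F F' x" and "F x = 0"
    and "d > 0" and lip: "C-lipschitz_on (ball x d) H"
    and zero: "\<And>y. y \<in> U \<Longrightarrow> H y (F y) = 0"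
  shows "H x (F' \<xi>) = 0"
proof -
  obtain y where y: "\<And>n. y n \<in> U" "y \<longlonglongrightarrow> x"
    using \<open>x \<in> closure U\<close> unfolding closure_sequential by blast
  have "\<exists>t. 0 < t \<and> t < inverse (real (Suc n)) \<and> y n + t *\<^sub>R \<xi> \<in> U" for n
  proof -
    obtain r where "r > 0" "ball (y n) r \<subseteq> U"
      using \<open>open U\<close> y(1) open_contains_ball by blast
    define t where "t = min (inverse (real (Suc n))) (r / (norm \<xi> + 1)) / 2"
    have c: "norm \<xi> + 1 > 0" by (simp add: add_nonneg_pos)
    have "min (inverse (real (Suc n))) (r / (norm \<xi> + 1)) > 0"
      using \<open>r > 0\<close> c by simp
    then have "0 < t" "2 * t \<le> inverse (real (Suc n))" "2 * t \<le> r / (norm \<xi> + 1)"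
      by (simp_all add: t_def del: of_nat_Suc)
    then have t: "0 < t" "t < inverse (real (Suc n))" "t < r / (norm \<xi> + 1)"
      by linarith+
    then have "t * (norm \<xi> + 1) < r" using c by (simp add: pos_less_divide_eq)
    then have "norm (t *\<^sub>R \<xi>) < r" using t(1) by (simp add: algebra_simps)
    then have "y n + t *\<^sub>R \<xi> \<in> ball (y n) r" by (simp add: dist_norm)
    then show ?thesis using \<open>ball (y n) r \<subseteq> U\<close> t by blast
  qed
  then obtain t where t: "\<And>n. 0 < t n" "\<And>n. t n < inverse (real (Suc n))" "\<And>n. y n + t n *\<^sub>R \<xi> \<in> U"
    by metis
  define z where "z n = y n + t n *\<^sub>R \<xi>" for n
  have "t \<longlonglongrightarrow> 0"
    by (rule tendsto_sandwich[OF _ _ tendsto_const LIMSEQ_inverse_real_of_nat])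
       (use t in \<open>auto intro!: always_eventually less_imp_le simp del: of_nat_Suc\<close>)
  then have z: "z \<longlonglongrightarrow> x"
    using tendsto_add[OF y(2) tendsto_scaleR[OF _ tendsto_const[of \<xi>], of t 0]] by (simp add: z_def[abs_def])
  have F'_lin: "linear F'" and contF: "isCont F x"
    using strictly_differentiable_imp_has_derivative[OF strict] has_derivative_linear has_derivative_continuous
    by blast+
  have quot: "(\<lambda>n. (F (z n) - F (y n)) /\<^sub>R t n) \<longlonglongrightarrow> F' \<xi>"
  proof (rule metric_LIMSEQ_I)
    fix e :: real assume "e > 0"
    define \<eta> where "\<eta> = e / (norm \<xi> + 1)"
    have "\<eta> > 0" using \<open>e > 0\<close> by (simp add: \<eta>_def add_nonneg_pos)
    have "\<eta> * norm \<xi> < \<eta> * (norm \<xi> + 1)" using \<open>\<eta> > 0\<close> by simp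
    also have "\<dots> = e" using norm_ge_zero[of \<xi>] by (simp add: \<eta>_def add_nonneg_eq_0_iff)
    finally have \<eta>: "\<eta> * norm \<xi> < e" .
    obtain \<delta> where "\<delta> > 0" and \<delta>: "\<And>y z. y \<in> ball x \<delta> \<Longrightarrow> z \<in> ball x \<delta> \<Longrightarrow>
        norm (F y - F z - F' (y - z)) \<le> \<eta> * norm (y - z)"
      using strict \<open>\<eta> > 0\<close> unfolding strictly_differentiable_def by blast
    have "\<forall>\<^sub>F n in sequentially. y n \<in> ball x \<delta> \<and> z n \<in> ball x \<delta>"
      using \<open>\<delta> > 0\<close> y(2) z by (auto simp: tendsto_iff dist_commute eventually_conj_iff)
    then obtain N where N: "\<And>n. n \<ge> N \<Longrightarrow> y n \<in> ball x \<delta> \<and> z n \<in> ball x \<delta>"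
      unfolding eventually_sequentially by blast
    have "dist ((F (z n) - F (y n)) /\<^sub>R t n) (F' \<xi>) < e" if "n \<ge> N" for n
    proof -
      have "norm (F (z n) - F (y n) - t n *\<^sub>R F' \<xi>) \<le> \<eta> * (t n * norm \<xi>)"
        using \<delta>[of "z n" "y n"] N[OF that] t(1)[of n] by (simp add: z_def linear_scale[OF F'_lin])
      moreover have "F (z n) - F (y n) - t n *\<^sub>R F' \<xi> = t n *\<^sub>R ((F (z n) - F (y n)) /\<^sub>R t n - F' \<xi>)"
        using t(1)[of n] by (simp add: scaleR_diff_right)
      ultimately have "t n * norm ((F (z n) - F (y n)) /\<^sub>R t n - F' \<xi>) \<le> t n * (\<eta> * norm \<xi>)"
        using t(1)[of n] by (simp add: mult_ac)
      then show ?thesis using t(1)[of n] \<eta> by (simp add: dist_norm)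
    qed
    then show "\<exists>N. \<forall>n\<ge>N. dist ((F (z n) - F (y n)) /\<^sub>R t n) (F' \<xi>) < e" by blast
  qed
  have "isCont H x"
    using lipschitz_on_continuous_on[OF lip] \<open>d > 0\<close> by (simp add: continuous_on_eq_continuous_at)
  then have "(\<lambda>n. H (y n)) \<longlonglongrightarrow> H x" using y(2) isCont_tendsto_compose by blast
  then have "(\<lambda>n. H (y n) ((F (z n) - F (y n)) /\<^sub>R t n)) \<longlonglongrightarrow> H x (F' \<xi>)"
    by (intro bounded_bilinear.tendsto[OF bounded_bilinear_blinfun_apply] quot)
  moreover have "(\<lambda>n. H (y n) ((F (z n) - F (y n)) /\<^sub>R t n)) \<longlonglongrightarrow> 0"
  proof (rule Lim_null_comparison)
    have "(\<lambda>n. C * norm \<xi> * norm (F (z n))) \<longlonglongrightarrow> C * norm \<xi> * norm (F x)"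
      using isCont_tendsto_compose[OF contF z] by (intro tendsto_intros)
    then show "(\<lambda>n. C * norm \<xi> * norm (F (z n))) \<longlonglongrightarrow> 0"
      using \<open>F x = 0\<close> by simp
    have "\<forall>\<^sub>F n in sequentially. y n \<in> ball x d \<and> z n \<in> ball x d"
      using \<open>d > 0\<close> y(2) z by (auto simp: tendsto_iff dist_commute eventually_conj_iff)
    then show "\<forall>\<^sub>F n in sequentially.
        norm (H (y n) ((F (z n) - F (y n)) /\<^sub>R t n)) \<le> C * norm \<xi> * norm (F (z n))"
    proof (rule eventually_mono)
      fix n assume n: "y n \<in> ball x d \<and> z n \<in> ball x d"
      \<comment> \<open>Both \<open>H (y n) (F (y n))\<close> and \<open>H (z n) (F (z n))\<close> vanish, so the increment of \<open>F\<close> can be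
        traded for an increment of \<open>H\<close>, at the price of a factor \<open>F (z n)\<close> that tends to zero.\<close>
      have "H (y n) (F (z n) - F (y n)) = (H (y n) - H (z n)) (F (z n))"
        using zero[OF y(1)] zero[of "z n"] t(3) by (simp add: z_def blinfun.bilinear_simps)
      also have "norm \<dots> \<le> norm (H (y n) - H (z n)) * norm (F (z n))" by (rule norm_blinfun)
      also have "\<dots> \<le> (C * (t n * norm \<xi>)) * norm (F (z n))"
        using lipschitz_onD[OF lip, of "y n" "z n"] n t(1)[of n]
        by (intro mult_right_mono) (auto simp: dist_norm z_def)
      finally have "norm (H (y n) (F (z n) - F (y n))) \<le> t n * (C * norm \<xi> * norm (F (z n)))"
        by (simp add: mult_ac)
      then show "norm (H (y n) ((F (z n) - F (y n)) /\<^sub>R t n)) \<le> C * norm \<xi> * norm (F (z n))"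
        using t(1)[of n] by (simp add: blinfun.scaleR_right divide_simps mult_ac)
    qed
  qed
  ultimately show ?thesis using LIMSEQ_unique by blast
qed

text \<open>
  The sum of the norms of the partial derivatives is continuous, hence bounded on the compact ball,
  and it dominates the operator norm of the derivative.
\<close>

lemma Ck_on_1_imp_lipschitz_on_cball:
  fixes k :: "'a::euclidean_space \<Rightarrow> 'b::euclidean_space"
  assumes "Ck_on (Suc 0) UNIV k"
  obtains L where "L-lipschitz_on (cball x 1) k"
proof -
  have deriv: "(k has_derivative frechet_derivative k (at y)) (at y)" for y
    using assms by (simp add: frechet_derivative_works)
  have cont: "continuous_on UNIV (\<lambda>y. frechet_derivative k (at y) v)" for v
    using assms by simp
  have "continuous_on (cball x 1) (\<lambda>y. \<Sum>b\<in>Basis. norm (frechet_derivative k (at y) b))"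
    by (intro continuous_intros continuous_on_subset[OF cont]) auto
  then have "bounded ((\<lambda>y. \<Sum>b\<in>Basis. norm (frechet_derivative k (at y) b)) ` cball x 1)"
    by (intro compact_imp_bounded compact_continuous_image) auto
  then obtain B where "\<forall>s \<in> (\<lambda>y. \<Sum>b\<in>Basis. norm (frechet_derivative k (at y) b)) ` cball x 1. norm s \<le> B"
    unfolding bounded_iff by blast
  then have B: "(\<Sum>b\<in>Basis. norm (frechet_derivative k (at y) b)) \<le> B" if "y \<in> cball x 1" for y
    using that by (auto dest: abs_le_D1)
  have "B \<ge> 0" using B[of x] by (meson centre_in_cball norm_ge_zero order_trans sum_nonneg zero_le_one)
  have "onorm (frechet_derivative k (at y)) \<le> B" if "y \<in> cball x 1" for y
  proof (rule onorm_le)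
    fix v
    have lin: "linear (frechet_derivative k (at y))" using deriv has_derivative_linear by blast
    have "norm (frechet_derivative k (at y) v) \<le> (\<Sum>b\<in>Basis. \<bar>v \<bullet> b\<bar> * norm (frechet_derivative k (at y) b))"
      by (subst euclidean_representation[of v, symmetric])
         (auto simp: linear_sum[OF lin] linear_scale[OF lin] simp del: euclidean_representation intro!: sum_norm_le)
    also have "\<dots> \<le> (\<Sum>b\<in>Basis. norm v * norm (frechet_derivative k (at y) b))"
      by (intro sum_mono mult_right_mono Basis_le_norm) auto
    also have "\<dots> \<le> B * norm v"
      using mult_left_mono[OF B[OF that], of "norm v"] by (simp add: sum_distrib_left mult.commute)
    finally show "norm (frechet_derivative k (at y) v) \<le> B * norm v" .
  qed
  then have "norm (k y - k z) \<le> B * norm (y - z)" if "y \<in> cball x 1" "z \<in> cball x 1" for y z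
    using that by (intro differentiable_bound[OF convex_cball has_derivative_at_withinI[OF deriv]]) auto
  then have "B-lipschitz_on (cball x 1) k"
    using \<open>B \<ge> 0\<close> by (intro lipschitz_onI) (auto simp: dist_norm)
  then show thesis using that by blast
qed

lemma Ck_on_2_imp_lipschitz_derivative:
  fixes h :: "'a::euclidean_space \<Rightarrow> 'b::euclidean_space"
  assumes "Ck_on (Suc (Suc 0)) UNIV h"
  obtains C where "C-lipschitz_on (cball x 1) (\<lambda>y. Blinfun (frechet_derivative h (at y)))"
proof -
  have bl: "bounded_linear (frechet_derivative h (at y))" for y
  proof -
    have "(h has_derivative frechet_derivative h (at y)) (at y)"
      using assms by (simp add: frechet_derivative_works)
    then show ?thesis by (rule has_derivative_bounded_linear)
  qed
  have "\<exists>L. L-lipschitz_on (cball x 1) (\<lambda>y. frechet_derivative h (at y) b)" for b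
  proof -
    have "Ck_on (Suc 0) UNIV (\<lambda>y. frechet_derivative h (at y) b)"
      using assms by (simp only: Ck_on.simps) blast
    then show ?thesis using Ck_on_1_imp_lipschitz_on_cball by metis
  qed
  then obtain L :: "'a \<Rightarrow> real" where L: "\<And>b. (L b)-lipschitz_on (cball x 1) (\<lambda>y. frechet_derivative h (at y) b)"
    by metis
  have "(\<Sum>b\<in>Basis. L b)-lipschitz_on (cball x 1) (\<lambda>y. Blinfun (frechet_derivative h (at y)))"
  proof (rule lipschitz_onI)
    fix y z assume yz: "y \<in> cball x 1" "z \<in> cball x 1"
    have "dist (Blinfun (frechet_derivative h (at y))) (Blinfun (frechet_derivative h (at z)))
        \<le> (\<Sum>b\<in>Basis. norm ((Blinfun (frechet_derivative h (at y)) - Blinfun (frechet_derivative h (at z))) b))"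
      unfolding dist_norm by (rule norm_blinfun_euclidean_le)
    also have "\<dots> \<le> (\<Sum>b\<in>Basis. L b * dist y z)"
      using lipschitz_onD[OF L yz]
      by (intro sum_mono) (simp add: blinfun.diff_left bounded_linear_Blinfun_apply bl dist_norm)
    finally show "dist (Blinfun (frechet_derivative h (at y))) (Blinfun (frechet_derivative h (at z)))
        \<le> (\<Sum>b\<in>Basis. L b) * dist y z" by (simp add: sum_distrib_right)
  qed (use L lipschitz_on_nonneg in \<open>blast intro: sum_nonneg\<close>)
  then show thesis using that by blast
qed

section \<open>Contingent cones and tangent spaces\<close>

lemma contingent_cone_mono: "S \<subseteq> T \<Longrightarrow> contingent_cone S x \<subseteq> contingent_cone T x"
  unfolding contingent_cone_def by blast

lemma subspace_tangent_space: "subspace (tangent_space S x)"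
  by (simp add: tangent_space_def)

lemma subspace_subset_contingent_cone_imp_subset_tangent_space:
  "K \<subseteq> contingent_cone S x \<Longrightarrow> K \<subseteq> tangent_space S x"
  unfolding tangent_space_def by (meson order_trans span_superset)

lemma contingent_coneI:
  assumes "\<And>e. e > 0 \<Longrightarrow> \<exists>t y. 0 < t \<and> t < e \<and> norm (y - v) < e \<and> x + t *\<^sub>R y \<in> S"
  shows "v \<in> contingent_cone S x"
proof -
  define e where "e j = inverse (real (Suc j))" for j
  have "e j > 0" for j by (simp add: e_def)
  then have "\<forall>j. \<exists>t y. 0 < t \<and> t < e j \<and> norm (y - v) < e j \<and> x + t *\<^sub>R y \<in> S"
    using assms by blast
  then obtain t y where ty: "\<And>j. 0 < t j" "\<And>j. t j < e j" "\<And>j. norm (y j - v) < e j"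
      "\<And>j. x + t j *\<^sub>R y j \<in> S"
    by metis
  have e: "e \<longlonglongrightarrow> 0" unfolding e_def by (rule LIMSEQ_inverse_real_of_nat)
  have "t \<longlonglongrightarrow> 0"
    by (rule tendsto_sandwich[OF _ _ tendsto_const e]) (use ty in \<open>auto intro!: always_eventually less_imp_le\<close>)
  moreover have "(\<lambda>j. norm (y j - v)) \<longlonglongrightarrow> 0"
    by (rule tendsto_sandwich[OF _ _ tendsto_const e]) (use ty in \<open>auto intro!: always_eventually less_imp_le\<close>)
  then have "y \<longlonglongrightarrow> v" using LIM_zero_iff tendsto_norm_zero_iff by blast
  ultimately show ?thesis unfolding contingent_cone_def using ty by blast
qed

lemma contingent_coneI_curve:
  assumes "(c has_vector_derivative v) (at 0)" and "e > 0"
    and "\<And>t. 0 < t \<Longrightarrow> t < e \<Longrightarrow> c t \<in> S" and "c 0 = x"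
  shows "v \<in> contingent_cone S x"
proof (rule contingent_coneI)
  fix \<epsilon> :: real assume "\<epsilon> > 0"
  have "\<epsilon> / 2 > 0" using \<open>\<epsilon> > 0\<close> by simp
  moreover have "(c has_derivative (\<lambda>t. t *\<^sub>R v)) (at 0)"
    using assms(1) by (simp add: has_vector_derivative_def)
  ultimately obtain d where "d > 0"
    and d: "\<And>t. norm t < d \<Longrightarrow> norm (c t - c 0 - t *\<^sub>R v) \<le> \<epsilon> / 2 * norm t"
    unfolding has_derivative_at_alt by (metis diff_zero)
  define t where "t = min (min d e) \<epsilon> / 2"
  have t: "0 < t" "t < d" "t < e" "t < \<epsilon>" using \<open>d > 0\<close> \<open>e > 0\<close> \<open>\<epsilon> > 0\<close> by (auto simp: t_def)
  define y where "y = (c t - x) /\<^sub>R t"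
  have "t *\<^sub>R (y - v) = c t - c 0 - t *\<^sub>R v"
    using t by (simp add: y_def assms(4) scaleR_diff_right)
  then have "t * norm (y - v) \<le> \<epsilon> / 2 * t"
    using d[of t] t by (metis abs_of_pos norm_scaleR real_norm_def)
  then have "norm (y - v) \<le> \<epsilon> / 2" using t by (simp add: mult.commute)
  then have "norm (y - v) < \<epsilon>" using \<open>\<epsilon> > 0\<close> by simp
  moreover have "x + t *\<^sub>R y \<in> S" using assms(3)[of t] t by (simp add: y_def)
  ultimately show "\<exists>t y. 0 < t \<and> t < \<epsilon> \<and> norm (y - v) < \<epsilon> \<and> x + t *\<^sub>R y \<in> S"
    using t by blast
qed

lemma tangent_space_subset_kernel:
  fixes G :: "'a::euclidean_space \<Rightarrow> 'b::real_normed_vector"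
  assumes deriv: "(G has_derivative G') (at x)" and const: "\<And>y. y \<in> S \<Longrightarrow> G y = G x"
  shows "tangent_space S x \<subseteq> {v. G' v = 0}"
proof -
  have lin: "linear G'" using deriv has_derivative_linear by blast
  have "contingent_cone S x \<subseteq> {v. G' v = 0}"
  proof clarify
    fix v assume "v \<in> contingent_cone S x"
    then obtain t y where t: "\<And>j::nat. t j > 0" "t \<longlonglongrightarrow> 0" and y: "y \<longlonglongrightarrow> v"
      and S: "\<And>j. x + t j *\<^sub>R y j \<in> S"
      unfolding contingent_cone_def by blast
    have "(\<lambda>j. G' (y j)) \<longlonglongrightarrow> G' v"
      using bounded_linear.tendsto[OF has_derivative_bounded_linear[OF deriv] y] .
    moreover have "(\<lambda>j. G' (y j)) \<longlonglongrightarrow> 0"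
    proof (rule LIMSEQ_I)
      fix e :: real assume "e > 0"
      obtain B where B: "B > 0" "\<And>j. norm (y j) \<le> B"
        using convergent_imp_Bseq[OF convergentI[OF y]] by (auto simp: Bseq_def)
      define \<eta> where "\<eta> = e / (2 * B)"
      have "\<eta> > 0" using \<open>e > 0\<close> B by (simp add: \<eta>_def)
      then obtain d where "d > 0"
        and d: "\<And>z. norm (z - x) < d \<Longrightarrow> norm (G z - G x - G' (z - x)) \<le> \<eta> * norm (z - x)"
        using deriv unfolding has_derivative_at_alt by blast
      obtain N where N: "\<And>j. j \<ge> N \<Longrightarrow> norm (t j) < d / B"
        using LIMSEQ_D[OF t(2), of "d / B"] \<open>d > 0\<close> B(1) by auto
      have "norm (G' (y j)) < e" if "j \<ge> N" for j
      proof -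
        have "norm (t j *\<^sub>R y j) \<le> t j * B"
          using B(2)[of j] t(1)[of j] by simp
        also have "\<dots> < d" using N[OF that] t(1)[of j] B(1) by (simp add: pos_less_divide_eq)
        finally have "norm (G' (t j *\<^sub>R y j)) \<le> \<eta> * norm (t j *\<^sub>R y j)"
          using d[of "x + t j *\<^sub>R y j"] const[OF S[of j]] by simp
        then have "norm (G' (y j)) \<le> \<eta> * norm (y j)"
          using t(1)[of j] by (simp add: linear_scale[OF lin])
        also have "\<dots> \<le> \<eta> * B" using B(2) \<open>\<eta> > 0\<close> by simp
        also have "\<dots> < e" using B(1) \<open>e > 0\<close> by (simp add: \<eta>_def)
        finally show ?thesis .
      qed
      then show "\<exists>N. \<forall>j\<ge>N. norm (G' (y j) - 0) < e" by auto
    qed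
    ultimately show "G' v = 0" using LIMSEQ_unique by blast
  qed
  then show ?thesis
    unfolding tangent_space_def by (rule span_minimal) (rule linear_subspace_kernel[OF lin])
qed

text \<open>
  Let \<open>D\<close> be one of the convex pieces of the local model that contain the image of \<open>u\<close>. The segments from
  that image into \<open>D\<close> are pulled back by the chart to curves in \<open>S\<close>. The
  initial velocities of the segments span a space of dimension \<open>d\<close>, and the derivative of the inverse chart
  is injective.
\<close>

lemma dim_tangent_space_ge:
  fixes S :: "'a::euclidean_space set"
  assumes "bd_submanifold_at d S u"
  shows "d \<le> dim (tangent_space S u)"
proof -
  obtain W \<Phi> L \<D> where "u \<in> S" "u \<in> W" and chart: "smooth_chart W \<Phi>"
    and D: "\<And>D. D \<in> \<D> \<Longrightarrow> convex D \<and> aff_dim D = int d"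
    and image: "\<Phi> ` (S \<inter> W) = \<Phi> ` W \<inter> \<Union>\<D>"
    using assms unfolding bd_submanifold_at_def by metis
  define \<Psi> where "\<Psi> = inv_into W \<Phi>"
  have W: "open W" "open (\<Phi> ` W)" and inj: "inj_on \<Phi> W"
    and "smooth_on W \<Phi>" "smooth_on (\<Phi> ` W) \<Psi>"
    using chart by (auto simp: smooth_chart_def \<Psi>_def)
  then have "Ck_on (Suc 0) W \<Phi>" "Ck_on (Suc 0) (\<Phi> ` W) \<Psi>"
    unfolding smooth_on_def by blast+
  then have "\<Phi> differentiable at u" "\<Psi> differentiable at (\<Phi> u)"
    using \<open>u \<in> W\<close> by auto
  then obtain \<Phi>' \<Psi>' where \<Phi>': "(\<Phi> has_derivative \<Phi>') (at u)" and \<Psi>': "(\<Psi> has_derivative \<Psi>') (at (\<Phi> u))"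
    by (auto simp: differentiable_def)
  have \<Psi>u: "\<Psi> (\<Phi> u) = u" using inj \<open>u \<in> W\<close> by (simp add: \<Psi>_def)
  have inv: "\<Phi> (\<Psi> z) = z" if "z \<in> \<Phi> ` W" for z
    using that by (simp add: \<Psi>_def f_inv_into_f)
  \<comment> \<open>Differentiating \<open>\<Phi> \<circ> \<Psi> = id\<close> gives a left inverse of \<open>\<Psi>'\<close>.\<close>
  have "((\<Phi> \<circ> \<Psi>) has_derivative (\<Phi>' \<circ> \<Psi>')) (at (\<Phi> u))"
    using \<Phi>' \<Psi>' \<Psi>u by (intro diff_chain_at) auto
  moreover have "((\<Phi> \<circ> \<Psi>) has_derivative id) (at (\<Phi> u))"
    by (rule has_derivative_transform_within_open[OF has_derivative_id W(2)])
       (use \<open>u \<in> W\<close> inv in auto)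
  ultimately have "\<Phi>' \<circ> \<Psi>' = id" using has_derivative_unique by blast
  then have "inj \<Psi>'" by (metis inj_on_id inj_on_imageI2)
  have lin: "linear \<Psi>'" using \<Psi>' has_derivative_linear by blast
  have "\<Phi> u \<in> \<Union>\<D>" using image \<open>u \<in> S\<close> \<open>u \<in> W\<close> by blast
  then obtain D where "D \<in> \<D>" "\<Phi> u \<in> D" by blast
  have "\<Psi>' (z - \<Phi> u) \<in> contingent_cone S u" if "z \<in> D" for z
  proof -
    define c where "c t = \<Phi> u + t *\<^sub>R (z - \<Phi> u)" for t
    have c: "(c has_derivative (\<lambda>t. t *\<^sub>R (z - \<Phi> u))) (at 0)"
      unfolding c_def by (auto intro!: derivative_eq_intros)
    have "c 0 = \<Phi> u" by (simp add: c_def)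
    with c \<Psi>' have "((\<Psi> \<circ> c) has_derivative (\<Psi>' \<circ> (\<lambda>t. t *\<^sub>R (z - \<Phi> u)))) (at 0)"
      by (intro diff_chain_at) auto
    then have vd: "((\<Psi> \<circ> c) has_vector_derivative \<Psi>' (z - \<Phi> u)) (at 0)"
      using lin by (simp add: has_vector_derivative_def o_def linear_scale)
    have "isCont c 0" using c has_derivative_continuous by blast
    then have "\<forall>\<^sub>F t in nhds 0. c t \<in> \<Phi> ` W"
      using W(2) \<open>c 0 = \<Phi> u\<close> \<open>u \<in> W\<close>
      by (metis image_eqI isCont_def tendsto_at_iff_tendsto_nhds topological_tendstoD)
    then obtain e where "e > 0" and e: "\<And>t. dist t 0 < e \<Longrightarrow> c t \<in> \<Phi> ` W"
      unfolding eventually_nhds_metric by blast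
    show ?thesis
    proof (rule contingent_coneI_curve[OF vd, of "min e 1"])
      fix t :: real assume t: "0 < t" "t < min e 1"
      have "c t = (1 - t) *\<^sub>R \<Phi> u + t *\<^sub>R z" by (simp add: c_def algebra_simps)
      also have "\<dots> \<in> D"
        using D[OF \<open>D \<in> \<D>\<close>] t \<open>z \<in> D\<close> \<open>\<Phi> u \<in> D\<close> by (intro convexD) auto
      finally have "c t \<in> \<Phi> ` (S \<inter> W)"
        unfolding image using e[of t] t \<open>D \<in> \<D>\<close> by auto
      then show "(\<Psi> \<circ> c) t \<in> S"
        using inj by (auto simp: \<Psi>_def)
    qed (use \<open>e > 0\<close> \<open>c 0 = \<Phi> u\<close> \<Psi>u in auto)
  qed
  then have "\<Psi>' ` ((\<lambda>z. z - \<Phi> u) ` D) \<subseteq> contingent_cone S u" by auto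
  then have "dim (\<Psi>' ` ((\<lambda>z. z - \<Phi> u) ` D)) \<le> dim (tangent_space S u)"
    unfolding tangent_space_def dim_span by (rule dim_subset)
  moreover have "dim (\<Psi>' ` ((\<lambda>z. z - \<Phi> u) ` D)) = dim ((\<lambda>z. z - \<Phi> u) ` D)"
    using lin \<open>inj \<Psi>'\<close> by (intro dim_image_eq) (auto intro: inj_on_subset)
  moreover have "int (dim ((\<lambda>z. z - \<Phi> u) ` D)) = int d"
    using aff_dim_eq_dim_subtract[of "\<Phi> u" D] D[OF \<open>D \<in> \<D>\<close>] \<open>\<Phi> u \<in> D\<close> by (simp add: hull_inc)
  ultimately show ?thesis by simp
qed

text \<open>
  A weak form of the implicit function theorem that asks only for differentiability at \<open>p\<close> and
  continuity nearby. With a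
  linear right inverse \<open>R\<close> of \<open>G'\<close> on its range, a zero of \<open>G\<close> is sought in the form
  \<open>p + t *\<^sub>R v + R w\<close>. Since \<open>G\<close> equals \<open>w\<close> there up to an error of order \<open>o(t)\<close>, the map
  \<open>w \<mapsto> w - G (p + t *\<^sub>R v + R w)\<close> sends a ball of radius \<open>o(t)\<close> in the range of \<open>G'\<close> to itself, and a
  fixed point of Brouwer is the required \<open>w\<close>. The range of \<open>G'\<close> may be a proper subspace, provided
  that \<open>G\<close> takes its values in it.
\<close>

lemma kernel_subset_contingent_cone_zero_set:
  fixes G :: "'a::euclidean_space \<Rightarrow> 'b::euclidean_space"
  assumes "open U" "p \<in> U" and cont: "continuous_on U G"
    and deriv: "(G has_derivative G') (at p)" and "G p = 0"
    and range: "\<And>y. y \<in> U \<Longrightarrow> G y \<in> range G'" and "G' v = 0"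
  shows "v \<in> contingent_cone {y \<in> U. G y = 0} p"
proof (rule contingent_coneI)
  fix e :: real assume "e > 0"
  have lin: "linear G'" using deriv has_derivative_linear by blast
  obtain R where R: "linear R" and GR: "\<And>w. w \<in> range G' \<Longrightarrow> G' (R w) = w"
    using linear_exists_right_inverse_on[OF lin subspace_UNIV] by blast
  obtain K where K: "K > 0" "\<And>w. norm (R w) \<le> K * norm w"
    using linear_bounded_pos[OF R] by blast
  define \<epsilon> where "\<epsilon> = e / (2 * K)"
  define c where "c = norm v + K * \<epsilon>"
  have "\<epsilon> > 0" using \<open>e > 0\<close> K by (simp add: \<epsilon>_def)
  then have "c > 0" using K by (simp add: c_def add_nonneg_pos)
  obtain d1 where "d1 > 0" "ball p d1 \<subseteq> U"
    using \<open>open U\<close> \<open>p \<in> U\<close> open_contains_ball by blast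
  have "\<epsilon> / c > 0" using \<open>\<epsilon> > 0\<close> \<open>c > 0\<close> by simp
  then obtain d2 where "d2 > 0"
    and d2: "\<And>y. norm (y - p) < d2 \<Longrightarrow> norm (G y - G p - G' (y - p)) \<le> (\<epsilon> / c) * norm (y - p)"
    using deriv unfolding has_derivative_at_alt by blast
  define t where "t = min (e / 2) (min d1 d2 / (2 * c))"
  have t: "0 < t" "t < e" using \<open>e > 0\<close> \<open>d1 > 0\<close> \<open>d2 > 0\<close> \<open>c > 0\<close> by (auto simp: t_def)
  have "t \<le> min d1 d2 / (2 * c)" by (simp add: t_def)
  then have "t * c \<le> min d1 d2 / 2" using \<open>c > 0\<close> by (simp add: field_simps)
  then have tc: "t * c < d1" "t * c < d2" using \<open>d1 > 0\<close> \<open>d2 > 0\<close> by (auto simp: min_def split: if_splits)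
  define B where "B = cball 0 (\<epsilon> * t) \<inter> range G'"
  define q where "q w = p + (t *\<^sub>R v + R w)" for w
  have sub: "subspace (range G')" using lin by (simp add: linear_subspace_image)
  have q_near: "norm (q w - p) \<le> t * c" if "w \<in> B" for w
  proof -
    have "norm (R w) \<le> K * (\<epsilon> * t)"
      using order_trans[OF K(2)[of w] mult_left_mono[of "norm w" "\<epsilon> * t" K]] that K(1) by (simp add: B_def)
    then show ?thesis
      using norm_triangle_ineq[of "t *\<^sub>R v" "R w"] t by (simp add: q_def c_def algebra_simps)
  qed
  have q_U: "q w \<in> U" if "w \<in> B" for w
    using q_near[OF that] tc(1) \<open>ball p d1 \<subseteq> U\<close> by (auto simp: dist_norm norm_minus_commute)
  have q_cont: "continuous_on B q"
    unfolding q_def using R by (intro continuous_intros linear_continuous_on) (simp add: linear_conv_bounded_linear)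
  have "\<exists>w\<in>B. w - G (q w) = w"
  proof -
    have "compact B" unfolding B_def using sub by (intro compact_Int_closed closed_subspace) auto
    moreover have "convex B" unfolding B_def using sub by (intro convex_Int convex_cball subspace_imp_convex)
    moreover have "0 \<in> B" using sub subspace_0 \<open>\<epsilon> > 0\<close> t by (auto simp: B_def)
    moreover have "continuous_on B (\<lambda>w. w - G (q w))"
      by (intro continuous_intros continuous_on_compose2[OF cont, of _ q])
         (auto simp: q_U q_cont)
    moreover have "(\<lambda>w. w - G (q w)) \<in> B \<rightarrow> B"
    proof
      fix w assume w: "w \<in> B"
      then have "w \<in> range G'" by (simp add: B_def)
      then have "G' (q w - p) = w"
        using lin GR \<open>G' v = 0\<close> by (simp add: q_def linear_add linear_scale)
      then have "norm (G (q w) - w) \<le> (\<epsilon> / c) * norm (q w - p)"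
        using d2[of "q w"] q_near[OF w] tc(2) \<open>G p = 0\<close> by simp
      also have "\<dots> \<le> (\<epsilon> / c) * (t * c)"
        using q_near[OF w] \<open>\<epsilon> > 0\<close> \<open>c > 0\<close> by (intro mult_left_mono) auto
      also have "\<dots> = \<epsilon> * t" using \<open>c > 0\<close> by simp
      finally show "w - G (q w) \<in> B"
        using sub \<open>w \<in> range G'\<close> range[OF q_U[OF w]]
        by (simp add: B_def norm_minus_commute subspace_diff)
    qed
    ultimately show ?thesis using brouwer[of B "\<lambda>w. w - G (q w)"] by blast
  qed
  then obtain w where w: "w \<in> B" "G (q w) = 0" by auto
  define y where "y = v + R w /\<^sub>R t"
  have "norm (R w) \<le> K * (\<epsilon> * t)"
    using order_trans[OF K(2)[of w] mult_left_mono[of "norm w" "\<epsilon> * t" K]] w(1) K(1) by (simp add: B_def)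
  also have "\<dots> = (e / 2) * t" using K(1) by (simp add: \<epsilon>_def)
  also have "\<dots> < e * t" using \<open>e > 0\<close> t by simp
  finally have "norm (y - v) < e" using t by (simp add: y_def divide_simps)
  moreover have "p + t *\<^sub>R y = q w" using t by (simp add: y_def q_def scaleR_add_right)
  then have "p + t *\<^sub>R y \<in> {y \<in> U. G y = 0}" using w q_U by simp
  ultimately show "\<exists>t y. 0 < t \<and> t < e \<and> norm (y - v) < e \<and> p + t *\<^sub>R y \<in> {y \<in> U. G y = 0}"
    using t by blast
qed

section \<open>The kernels of the derivatives\<close>

text \<open>
  The linear situation at an equilibrium: \<open>F'\<close> is the derivative of \<open>f\<close> in parameter and state,
  \<open>\<lambda>v. F' (0, v)\<close> is the state derivative \<open>A\<close>, and \<open>H\<close> is the derivative of the first integrals.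
\<close>

context
  fixes F' :: "'p::euclidean_space \<times> 'x::euclidean_space \<Rightarrow> 'x"
    and H :: "'x \<Rightarrow> 'c::euclidean_space"
  assumes F': "linear F'" and H: "linear H" "surj H" and HF: "\<And>u. H (F' u) = 0"
    and split: "is_direct_sum UNIV {v. F' (0, v) = 0} (range (\<lambda>v. F' (0, v)))"
    and rank: "dim (range (\<lambda>v. F' (0, v))) = DIM('x) - DIM('c)"
begin

lemma linear_partial: "linear (\<lambda>v. F' (0, v))"
proof -
  have "linear (\<lambda>v::'x. (0::'p, v))" by (rule linearI) auto
  from linear_compose[OF this F'] show ?thesis by (simp add: o_def)
qed

lemma split_state:
  obtains b w where "F' (0, b) = 0" "v = b + F' (0, w)"
proof -
  have "v \<in> {a + b |a b. a \<in> {v. F' (0, v) = 0} \<and> b \<in> range (\<lambda>v. F' (0, v))}"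
    using split unfolding is_direct_sum_def by (metis UNIV_I)
  then show thesis using that by blast
qed

text \<open>
  Since \<open>H\<close> vanishes on the range of \<open>A\<close>, it loses nothing when it is restricted to the complement \<open>ker A\<close>.
\<close>

lemma image_state_kernel: "H ` {v. F' (0, v) = 0} = UNIV"
proof -
  have "\<exists>b. F' (0, b) = 0 \<and> H b = c" for c
  proof -
    obtain v where v: "H v = c" using H(2) by (metis surjD)
    obtain b w where "F' (0, b) = 0" "v = b + F' (0, w)" by (rule split_state)
    with v show ?thesis using HF by (auto simp: linear_add[OF H(1)])
  qed
  then show ?thesis by (auto simp: image_iff) (metis)
qed

lemma dim_state_kernel: "dim {v. F' (0, v) = 0} = DIM('c)"
proof (rule antisym)
  have "DIM('c) \<le> DIM('x)"
    using dim_image_le[OF H(1), of UNIV] H(2) by simp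
  moreover have "dim {v. F' (0, v) = 0} + dim (range (\<lambda>v. F' (0, v))) = DIM('x)"
    using split dim_sums_Int[of "{v. F' (0, v) = 0}" "range (\<lambda>v. F' (0, v))"]
    by (simp add: is_direct_sum_def)
  ultimately show "dim {v. F' (0, v) = 0} \<le> DIM('c)" using rank by simp
  show "DIM('c) \<le> dim {v. F' (0, v) = 0}"
    using dim_image_le[OF H(1), of "{v. F' (0, v) = 0}"] by (simp add: image_state_kernel)
qed

text \<open>
  Transversality: \<open>H\<close> maps \<open>ker A\<close> onto a space of the same dimension, so it is injective there.
\<close>

lemma state_kernel_Int_integral_kernel:
  assumes "F' (0, v) = 0" "H v = 0"
  shows "v = 0"
proof -
  have sub: "subspace {v. F' (0, v) = 0}" by (rule linear_subspace_kernel[OF linear_partial])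
  obtain g where g: "range g \<subseteq> {v. F' (0, v) = 0}" "linear g" "\<And>c. H (g c) = c"
    using linear_exists_right_inverse_on[OF H(1) sub] unfolding image_state_kernel by blast
  have "inj g" by (metis g(3) injI)
  have "dim (range g) = DIM('c)" using dim_image_eq[OF g(2), of UNIV] \<open>inj g\<close> by simp
  then have "range g = {v. F' (0, v) = 0}"
    using g(1) g(2) sub by (intro subspace_dim_equal) (auto simp: dim_state_kernel linear_subspace_image)
  then obtain c where "v = g c" using assms(1) by blast
  with assms(2) g(2,3) show ?thesis by (simp add: linear_0)
qed

text \<open>
  Split the state component of \<open>v\<close> along \<open>ker A \<oplus> im A\<close>. The \<open>ker A\<close> part is itself in the kernel of
  \<open>F'\<close>, hence so is the rest, whose state component is in \<open>im A\<close> and therefore killed by \<open>H\<close>.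
\<close>

lemma is_direct_sum_kernel:
  "is_direct_sum {u. F' u = 0} {u. F' u = 0 \<and> H (snd u) = 0} (Pair 0 ` {v. F' (0, v) = 0})"
  unfolding is_direct_sum_def
proof (intro conjI)
  show "subspace {u. F' u = 0 \<and> H (snd u) = 0}"
    using F' H(1) by (auto simp: subspace_def linear_0 linear_add linear_scale)
  have "linear (Pair (0::'p) :: 'x \<Rightarrow> 'p \<times> 'x)" by (rule linearI) auto
  then show "subspace (Pair (0::'p) ` {v. F' (0, v) = 0})"
    by (rule linear_subspace_image[OF _ linear_subspace_kernel[OF linear_partial]])
  show "{u. F' u = 0 \<and> H (snd u) = 0} \<inter> Pair 0 ` {v. F' (0, v) = 0} = {0}"
    using state_kernel_Int_integral_kernel linear_0[OF linear_partial] linear_0[OF H(1)]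
    by (auto simp: zero_prod_def)
  show "{u. F' u = 0} = {a + b |a b. a \<in> {u. F' u = 0 \<and> H (snd u) = 0} \<and> b \<in> Pair 0 ` {v. F' (0, v) = 0}}"
  proof (intro equalityI subsetI)
    fix u assume "u \<in> {u. F' u = 0}"
    then have u: "F' u = 0" by simp
    obtain b w where b: "F' (0, b) = 0" "snd u = b + F' (0, w)" by (rule split_state)
    define a where "a = (fst u, F' (0, w))"
    have eq: "u = a + (0, b)" using b(2) by (simp add: a_def prod_eq_iff)
    then have "F' a = 0" using u b(1) by (simp add: linear_add[OF F'])
    moreover have "H (snd a) = 0" by (simp add: a_def HF)
    ultimately show "u \<in> {a + b |a b. a \<in> {u. F' u = 0 \<and> H (snd u) = 0} \<and> b \<in> Pair 0 ` {v. F' (0, v) = 0}}"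
      using eq b(1) by blast
  next
    fix u assume "u \<in> {a + b |a b. a \<in> {u. F' u = 0 \<and> H (snd u) = 0} \<and> b \<in> Pair 0 ` {v. F' (0, v) = 0}}"
    then obtain a v where "u = a + (0, v)" "F' a = 0" "F' (0, v) = 0" by blast
    then show "u \<in> {u. F' u = 0}" using linear_add[OF F', of a "(0, v)"] by simp
  qed
qed

text \<open>
  A vector of this kernel is determined by its parameter component, by transversality.
\<close>

lemma dim_level_kernel: "dim {u. F' u = 0 \<and> H (snd u) = 0} \<le> DIM('p)"
proof -
  let ?K = "{u. F' u = 0 \<and> H (snd u) = 0}"
  have sub: "subspace ?K" using is_direct_sum_kernel by (simp add: is_direct_sum_def)
  have "linear (fst :: 'p \<times> 'x \<Rightarrow> 'p)" by (rule linearI) auto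
  moreover have "inj_on fst ?K"
  proof (rule inj_onI)
    fix u w assume "u \<in> ?K" "w \<in> ?K" "fst u = fst w"
    then have "F' (0, snd (u - w)) = 0" "H (snd (u - w)) = 0"
      using subspace_diff[OF sub, of u w] by (auto simp: minus_prod_def zero_prod_def)
    then have "snd (u - w) = 0" by (rule state_kernel_Int_integral_kernel)
    then show "u = w" using \<open>fst u = fst w\<close> by (simp add: prod_eq_iff)
  qed
  ultimately have "dim (fst ` ?K) = dim ?K"
    using sub by (intro dim_image_eq) (auto simp: span_eq_iff[THEN iffD2])
  then show ?thesis using dim_subset_UNIV[of "fst ` ?K"] by simp
qed

lemma dim_kernel: "dim {u. F' u = 0} \<le> DIM('p) + DIM('c)"
proof -
  let ?A = "{u. F' u = 0 \<and> H (snd u) = 0}" and ?B = "Pair 0 ` {v. F' (0, v) = 0} :: ('p \<times> 'x) set"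
  have "linear (Pair (0::'p) :: 'x \<Rightarrow> 'p \<times> 'x)" by (rule linearI) auto
  then have "dim ?B \<le> DIM('c)"
    using dim_image_le[of "Pair (0::'p) :: 'x \<Rightarrow> 'p \<times> 'x" "{v. F' (0, v) = 0}"] by (simp add: dim_state_kernel)
  moreover have "dim {u. F' u = 0} + dim (?A \<inter> ?B) = dim ?A + dim ?B"
    using is_direct_sum_kernel dim_sums_Int[of ?A ?B] by (simp add: is_direct_sum_def)
  ultimately show ?thesis using dim_level_kernel by linarith
qed

text \<open>
  Transversality is an open condition on \<open>H\<close>, because an injective linear map is bounded below.
\<close>

lemma state_kernel_Int_integral_kernel_nearby:
  obtains B where "B > 0"
    "\<And>T C v. (\<And>w. norm (T w - H w) \<le> C * norm w) \<Longrightarrow> C < B \<Longrightarrow> F' (0, v) = 0 \<Longrightarrow> T v = 0 \<Longrightarrow> v = 0"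
proof -
  let ?L = "\<lambda>v. (F' (0, v), H v)"
  have "linear ?L"
    by (rule linearI) (simp_all add: linear_add[OF linear_partial] linear_add[OF H(1)]
        linear_scale[OF linear_partial] linear_scale[OF H(1)])
  moreover have "inj ?L"
    using state_kernel_Int_integral_kernel
    by (subst linear_injective_0[OF \<open>linear ?L\<close>]) (auto simp: zero_prod_def)
  ultimately obtain B where B: "B > 0" "\<And>v. B * norm v \<le> norm (?L v)"
    using linear_inj_bounded_below_pos by blast
  show thesis
  proof (rule that[OF B(1)])
    fix T :: "'x \<Rightarrow> 'c" and C v assume "\<And>w. norm (T w - H w) \<le> C * norm w" "C < B" "F' (0, v) = 0" "T v = 0"
    then have "norm (H v) \<le> C * norm v" "norm (?L v) = norm (H v)"
      by (metis diff_0 norm_minus_cancel, simp add: norm_Pair)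
    then have "B * norm v \<le> C * norm v" using B(2)[of v] by simp
    then show "v = 0" using \<open>C < B\<close> by (metis mult_le_cancel_right norm_ge_zero norm_le_zero_iff not_le)
  qed
qed

text \<open>
  The equation \<open>f = 0\<close> is not regular, since \<open>F'\<close> maps into the proper subspace \<open>im A\<close> while \<open>f\<close> need not.
  It is replaced by \<open>A (f) = 0\<close>, whose left hand side takes its values in \<open>im A\<close> and has the derivative
  \<open>A \<circ> F'\<close> with range \<open>im A\<close>, because \<open>A\<close> is invertible on \<open>im A\<close>. Near \<open>x\<close> nothing is lost:
  a value of \<open>f\<close> that lies in \<open>ker A\<close> is killed by \<open>Dh\<close> as well and so vanishes.
\<close>

lemma kernels_subset_contingent_cones_interior:
  fixes f :: "'p \<times> 'x \<Rightarrow> 'x" and h :: "'x \<Rightarrow> 'c" and Dh :: "'x \<Rightarrow> ('x \<Rightarrow>\<^sub>L 'c)"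
  assumes "open \<Lambda>" "l \<in> \<Lambda>" "x \<in> interior V"
    and contf: "continuous_on (\<Lambda> \<times> V) f" and derivf: "(f has_derivative F') (at (l, x))"
    and "f (l, x) = 0"
    and derivh: "\<And>y. (h has_derivative Dh y) (at y)" and "isCont Dh x" and H_eq: "blinfun_apply (Dh x) = H"
    and tangency: "\<And>w. w \<in> \<Lambda> \<times> interior V \<Longrightarrow> Dh (snd w) (f w) = 0"
  shows "{v. F' (0, v) = 0} \<subseteq> contingent_cone {y \<in> V. f (l, y) = 0} x" (is "?A \<subseteq> ?fib")
    and "{u. F' u = 0 \<and> H (snd u) = 0}
         \<subseteq> contingent_cone {w \<in> \<Lambda> \<times> V. f w = 0 \<and> h (snd w) = h x} (l, x)" (is "?B \<subseteq> ?lev")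
proof -
  define A where "A v = F' (0, v)" for v
  have A: "linear A" unfolding A_def by (rule linear_partial)
  have blA: "bounded_linear A" using A by (simp add: linear_conv_bounded_linear)
  obtain B where B: "B > 0"
    "\<And>T C v. (\<And>w. norm (T w - H w) \<le> C * norm w) \<Longrightarrow> C < B \<Longrightarrow> A v = 0 \<Longrightarrow> T v = 0 \<Longrightarrow> v = 0"
    unfolding A_def by (rule state_kernel_Int_integral_kernel_nearby) blast
  obtain d1 where d1: "d1 > 0" "ball x d1 \<subseteq> interior V"
    using \<open>x \<in> interior V\<close> open_contains_ball open_interior by blast
  obtain d2 where d2: "d2 > 0" "\<And>y. dist y x < d2 \<Longrightarrow> dist (Dh y) (Dh x) < B"
    using \<open>isCont Dh x\<close> B(1) unfolding continuous_at_eps_delta by blast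
  define N where "N = ball x (min d1 d2)"
  have N: "open N" "x \<in> N" "N \<subseteq> interior V" "N \<subseteq> V"
    using d1 d2(1) interior_subset[of V] by (auto simp: N_def)
  have vanish: "f w = 0" if w: "w \<in> \<Lambda> \<times> N" and "A (f w) = 0" for w
  proof (rule B(2)[of "Dh (snd w)" "norm (Dh (snd w) - Dh x)"])
    show "norm (Dh (snd w) v - H v) \<le> norm (Dh (snd w) - Dh x) * norm v" for v
      unfolding H_eq[symmetric] blinfun.diff_left[symmetric] by (rule norm_blinfun)
    show "norm (Dh (snd w) - Dh x) < B"
      using d2(2)[of "snd w"] w by (auto simp: N_def dist_norm norm_minus_commute)
    show "Dh (snd w) (f w) = 0" using tangency[of w] w N(3) by auto
  qed fact
  have image_AA: "\<exists>z. A (A z) = A w" for w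
  proof -
    obtain b z where "A b = 0" "w = b + A z" unfolding A_def by (rule split_state)
    then show ?thesis by (auto simp: linear_add[OF A])
  qed
  show "?A \<subseteq> ?fib"
  proof
    fix v assume "v \<in> ?A"
    define G where "G y = A (f (l, y))" for y
    have "(f has_derivative F') (at ((\<lambda>y. (l, y)) x))" using derivf by simp
    moreover have "((\<lambda>y. (l, y)) has_derivative (\<lambda>v. (0, v))) (at x)"
      by (auto intro!: derivative_eq_intros)
    ultimately have "((f \<circ> (\<lambda>y. (l, y))) has_derivative (F' \<circ> (\<lambda>v. (0, v)))) (at x)"
      by (intro diff_chain_at)
    then have "((\<lambda>y. f (l, y)) has_derivative A) (at x)"
      by (simp add: o_def A_def[abs_def])
    then have derivG: "(G has_derivative (\<lambda>v. A (A v))) (at x)"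
      unfolding G_def by (rule bounded_linear.has_derivative[OF blA])
    have "continuous_on N G"
      unfolding G_def using N(4) \<open>l \<in> \<Lambda>\<close>
      by (intro linear_continuous_on_compose[OF _ A] continuous_on_compose2[OF contf] continuous_intros) auto
    then have "v \<in> contingent_cone {y \<in> N. G y = 0} x"
    proof (rule kernel_subset_contingent_cone_zero_set[OF N(1,2) _ derivG])
      show "G x = 0" using \<open>f (l, x) = 0\<close> by (simp add: G_def linear_0[OF A])
      show "A (A v) = 0" using \<open>v \<in> ?A\<close> by (simp add: A_def[symmetric] linear_0[OF A])
      show "G y \<in> range (\<lambda>v. A (A v))" for y
        using image_AA[of "f (l, y)"] unfolding G_def by (metis rangeI)
    qed
    moreover have "{y \<in> N. G y = 0} \<subseteq> {y \<in> V. f (l, y) = 0}"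
      using vanish \<open>l \<in> \<Lambda>\<close> N(4) by (auto simp: G_def)
    ultimately show "v \<in> ?fib" using contingent_cone_mono by blast
  qed
  show "?B \<subseteq> ?lev"
  proof
    fix u assume "u \<in> ?B"
    define G where "G w = (A (f w), h (snd w) - h x)" for w
    define G' where "G' u = (A (F' u), H (snd u))" for u
    have "((\<lambda>w. A (f w)) has_derivative (\<lambda>u. A (F' u))) (at (l, x))"
      by (rule bounded_linear.has_derivative[OF blA derivf])
    moreover have "((h \<circ> snd) has_derivative (H \<circ> snd)) (at (l, x))"
      using derivh[of x] by (intro diff_chain_at has_derivative_snd has_derivative_ident) (simp add: H_eq)
    then have "((\<lambda>w. h (snd w) - h x) has_derivative (\<lambda>u. H (snd u))) (at (l, x))"
      by (auto simp: o_def intro!: derivative_eq_intros)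
    ultimately have derivG: "(G has_derivative G') (at (l, x))"
      unfolding G_def G'_def by (rule has_derivative_Pair)
    have "continuous_on UNIV h"
      using derivh has_derivative_continuous by (blast intro: continuous_at_imp_continuous_on)
    then have "continuous_on (\<Lambda> \<times> N) (\<lambda>w. h (snd w))"
      by (rule continuous_on_compose2[OF _ continuous_on_snd[OF continuous_on_id]]) simp
    moreover have "continuous_on (\<Lambda> \<times> N) f"
      by (rule continuous_on_subset[OF contf]) (use N(4) in auto)
    then have "continuous_on (\<Lambda> \<times> N) (\<lambda>w. A (f w))"
      by (rule linear_continuous_on_compose[OF _ A])
    ultimately have contG: "continuous_on (\<Lambda> \<times> N) G"
      unfolding G_def by (intro continuous_on_Pair continuous_on_diff continuous_on_const)
    have "u \<in> contingent_cone {w \<in> \<Lambda> \<times> N. G w = 0} (l, x)"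
    proof (rule kernel_subset_contingent_cone_zero_set[OF _ _ contG derivG])
      show "open (\<Lambda> \<times> N)" "(l, x) \<in> \<Lambda> \<times> N"
        using assms(1,2) N(1,2) by (auto simp: open_Times)
      show "G (l, x) = 0" using \<open>f (l, x) = 0\<close> by (simp add: G_def linear_0[OF A] zero_prod_def)
      show "G' u = 0" using \<open>u \<in> ?B\<close> by (simp add: G'_def linear_0[OF A] zero_prod_def)
      show "G w \<in> range G'" for w
      proof -
        \<comment> \<open>Solve the first component in \<open>im A\<close>, then correct the second one by a vector of \<open>ker A\<close>.\<close>
        obtain z where z: "A (A z) = A (f w)" using image_AA by blast
        obtain b where b: "A b = 0" "H b = h (snd w) - h x - H z"
          using image_state_kernel unfolding A_def by (metis (mono_tags, lifting) UNIV_I imageE mem_Collect_eq)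
        have "G' (0, z + b) = G w"
          using z b by (simp add: G_def G'_def A_def[symmetric] linear_add[OF A] linear_add[OF H(1)])
        then show ?thesis by (metis rangeI)
      qed
    qed
    moreover have "{w \<in> \<Lambda> \<times> N. G w = 0} \<subseteq> {w \<in> \<Lambda> \<times> V. f w = 0 \<and> h (snd w) = h x}"
      using vanish N(4) by (auto simp: G_def zero_prod_def)
    ultimately show "u \<in> ?lev" using contingent_cone_mono by blast
  qed
qed

end

section \<open>The tangent space of the equilibrium locus splits\<close>

lemma independent_gradients_imp_surj:
  assumes "independent_gradients_at h y"
  shows "surj (\<lambda>v. jacobian h (at y) *v v)"
proof -
  have "\<forall>c. (\<Sum>i\<in>UNIV. c i *s row i (jacobian h (at y))) = 0 \<longrightarrow> (\<forall>i. c i = 0)"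
    using assms unfolding independent_gradients_at_def
    by (simp add: row_def scalar_mult_eq_scaleR)
  then show ?thesis
    using matrix_right_invertible_independent_rows matrix_right_invertible_surjective by blast
qed

theorem lemma3:
  fixes \<Lambda> :: "(real^'m) set" and V :: "(real^'n) set"
    and f :: "(real^'m) \<times> (real^'n) \<Rightarrow> real^'n"
    and h :: "real^'n \<Rightarrow> real^'k"
    and a :: "real^'k" and lam :: "real^'m" and x :: "real^'n"
    and E :: "((real^'m) \<times> (real^'n)) set"
  assumes E_eq: "E = equilibria \<Lambda> V f"
    and Lambda: "open \<Lambda>" "connected \<Lambda>"
    and V: "compact V" "codim0_submanifold V" "stratified_manifold (frontier V)"
    and analytic: "\<forall>u \<in> \<Lambda> \<times> V. real_analytic_at f u"
    and stays_inside: "\<forall>l\<in>\<Lambda>. \<forall>y\<in>frontier V. f (l, y) \<in> contingent_cone V y"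
    and h_smooth: "smooth_on UNIV h"
    and first_integrals: "\<forall>l\<in>\<Lambda>. \<forall>i. first_integral_on V (\<lambda>y. f (l, y)) (\<lambda>y. h y $ i)"
    and h_independent: "\<forall>y. independent_gradients_at h y"
    and E_nonempty: "E \<noteq> {}"
    and E_manifold: "\<forall>u\<in>E. bd_submanifold_at (CARD('m) + CARD('k)) E u"
    and nondeg_i: "\<forall>u \<in> \<Lambda> \<times> V. rank (D_par f u) = min CARD('m) (CARD('n) - CARD('k))"
    and nondeg_ii_E: "\<forall>u\<in>E. rank (D_state f u) = CARD('n) - CARD('k)"
    and nondeg_ii_not_E: "\<forall>u \<in> \<Lambda> \<times> V - E. \<exists>p \<le> CARD('k). rank (D_state f u) = CARD('n) - p"
    and nondeg_iii: "\<forall>u\<in>E. is_direct_sum UNIV {v. D_state f u *v v = 0} (range ((*v) (D_state f u)))"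
    and pi_surj: "fst ` E = \<Lambda>"
    and u: "(lam, x) \<in> level_set \<Lambda> V f h a"
    and boundary_case: "x \<in> frontier V \<longrightarrow>
           bd_submanifold_at CARD('m) (level_set \<Lambda> V f h a) (lam, x)
         \<and> bd_submanifold_at CARD('k) (fiber V f lam) x"
  shows "is_direct_sum (tangent_space E (lam, x))
           (tangent_space (level_set \<Lambda> V f h a) (lam, x))
           (Pair 0 ` tangent_space (fiber V f lam) x)"
proof -
  have u_mem: "lam \<in> \<Lambda>" "x \<in> V" "f (lam, x) = 0" "h x = a" "(lam, x) \<in> E"
    using u by (auto simp: level_set_def equilibria_def E_eq)
  obtain F' where strict: "strictly_differentiable f F' (lam, x)"
    using real_analytic_at_imp_strictly_differentiable analytic u_mem by blast
  have derivf: "(f has_derivative F') (at (lam, x))"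
    by (rule strictly_differentiable_imp_has_derivative[OF strict])
  have F': "linear F'" using derivf by (rule has_derivative_linear)
  have "((f \<circ> Pair lam) has_derivative (F' \<circ> Pair 0)) (at x)"
    using derivf by (intro diff_chain_at) (auto intro!: derivative_eq_intros)
  then have derivf_state: "((\<lambda>y. f (lam, y)) has_derivative (\<lambda>v. F' (0, v))) (at x)"
    by (simp add: o_def)
  have D_state: "D_state f (lam, x) *v v = F' (0, v)" for v
  proof -
    have "((\<lambda>y. f (lam, y)) has_derivative (\<lambda>v. D_state f (lam, x) *v v)) (at x)"
      using derivf_state jacobian_works[of "\<lambda>y. f (lam, y)" "at x"]
      by (auto simp: D_state_def differentiable_def)
    then show ?thesis using derivf_state has_derivative_unique by metis
  qed

  define Dh where "Dh y = Blinfun (frechet_derivative h (at y))" for y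
  have Ck2: "Ck_on (Suc (Suc 0)) UNIV h" using h_smooth unfolding smooth_on_def by blast
  then have diffh: "h differentiable (at y)" for y by simp
  then have derivh0: "(h has_derivative frechet_derivative h (at y)) (at y)" for y
    by (simp add: frechet_derivative_works)
  have Dh_apply: "blinfun_apply (Dh y) = frechet_derivative h (at y)" for y
    unfolding Dh_def by (intro bounded_linear_Blinfun_apply has_derivative_bounded_linear[OF derivh0])
  have derivh: "(h has_derivative Dh y) (at y)" for y using derivh0 by (simp add: Dh_apply)
  obtain C where lip: "C-lipschitz_on (cball x 1) Dh"
    unfolding Dh_def using Ck_on_2_imp_lipschitz_derivative[OF Ck2] by blast
  have "continuous_on (ball x 1) Dh"
    using lipschitz_on_continuous_on[OF lip] continuous_on_subset ball_subset_cball by blast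
  then have contDh: "isCont Dh x" by (simp add: continuous_on_eq_continuous_at)
  define H where "H = blinfun_apply (Dh x)"
  have H: "linear H" unfolding H_def using derivh has_derivative_linear by blast
  have "H = (\<lambda>v. jacobian h (at x) *v v)"
    using derivh[of x] diffh[of x] jacobian_works[of h "at x"] has_derivative_unique
    unfolding H_def by blast
  then have surjH: "surj H"
    using independent_gradients_imp_surj h_independent by metis

  have tangency: "Dh (snd w) (f w) = 0" if w_mem: "w \<in> \<Lambda> \<times> interior V" for w
  proof -
    obtain l y where w: "w = (l, y)" "l \<in> \<Lambda>" "y \<in> interior V" using w_mem by (cases w) auto
    then have "real_analytic_at f (l, y)" using analytic interior_subset by blast
    then obtain L d where "d > 0" and L: "L-lipschitz_on (ball (l, y) d) f"
      using real_analytic_at_imp_strictly_differentiable strictly_differentiable_imp_lipschitz by metis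
    have "L-lipschitz_on (ball y d) (\<lambda>z. f (l, z))"
    proof (rule lipschitz_onI)
      fix z z' assume "z \<in> ball y d" "z' \<in> ball y d"
      then show "dist (f (l, z)) (f (l, z')) \<le> L * dist z z'"
        using lipschitz_onD[OF L, of "(l, z)" "(l, z')"] by (simp add: dist_Pair_Pair)
    qed (rule lipschitz_on_nonneg[OF L])
    note * = first_integral_derivative_vanishes[OF w(3) \<open>d > 0\<close> this]
    have "Dh y (f (l, y)) $ i = 0" for i
    proof (rule *[of "\<lambda>z. h z $ i" "\<lambda>v. Dh y v $ i"])
      show "first_integral_on V (\<lambda>z. f (l, z)) (\<lambda>z. h z $ i)"
        using first_integrals w(2) by blast
      show "((\<lambda>z. h z $ i) has_derivative (\<lambda>v. Dh y v $ i)) (at y)"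
        by (rule bounded_linear.has_derivative[OF bounded_linear_vec_nth derivh])
    qed
    then show ?thesis by (simp add: w(1) vec_eq_iff)
  qed
  have HF: "H (F' v) = 0" for v
  proof -
    have "Dh (snd (lam, x)) (F' v) = 0"
    proof (rule annihilator_kills_derivative_at_zero[OF _ _ strict u_mem(3) zero_less_one])
      show "open (\<Lambda> \<times> interior V)" using Lambda by (simp add: open_Times)
      show "(lam, x) \<in> closure (\<Lambda> \<times> interior V)"
        using codim0_submanifold_subset_closure_interior[OF V(2)] u_mem closure_subset
        by (auto simp: closure_Times)
      show "C-lipschitz_on (ball (lam, x) 1) (\<lambda>w. Dh (snd w))"
      proof (rule lipschitz_onI)
        fix w w' :: "(real^'m) \<times> (real^'n)" assume "w \<in> ball (lam, x) 1" "w' \<in> ball (lam, x) 1"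
        then have "snd w \<in> cball x 1" "snd w' \<in> cball x 1"
          using dist_snd_le[of "(lam, x)" w] dist_snd_le[of "(lam, x)" w'] by auto
        then have "dist (Dh (snd w)) (Dh (snd w')) \<le> C * dist (snd w) (snd w')"
          by (rule lipschitz_onD[OF lip])
        also have "\<dots> \<le> C * dist w w'"
          by (intro mult_left_mono dist_snd_le lipschitz_on_nonneg[OF lip])
        finally show "dist (Dh (snd w)) (Dh (snd w')) \<le> C * dist w w'" .
      qed (rule lipschitz_on_nonneg[OF lip])
    qed (rule tangency)
    then show ?thesis by (simp add: H_def)
  qed

  have split: "is_direct_sum UNIV {v. F' (0, v) = 0} (range (\<lambda>v. F' (0, v)))"
    using nondeg_iii u_mem(5) D_state by (metis (mono_tags, lifting) Collect_cong image_cong)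
  have rank: "dim (range (\<lambda>v. F' (0, v))) = DIM(real^'n) - DIM(real^'k)"
    using nondeg_ii_E u_mem(5) by (simp add: rank_dim_range flip: D_state)
  note linear_facts = F' H surjH HF split rank
  let ?K = "{v. F' v = 0}" and ?A = "{v. F' (0, v) = 0}" and ?B = "{v. F' v = 0 \<and> H (snd v) = 0}"
  have direct: "is_direct_sum ?K ?B (Pair 0 ` ?A)"
    by (rule is_direct_sum_kernel[OF linear_facts])

  have subE: "tangent_space E (lam, x) \<subseteq> ?K"
    by (rule tangent_space_subset_kernel[OF derivf]) (use u_mem in \<open>auto simp: E_eq equilibria_def\<close>)
  have subF: "tangent_space (fiber V f lam) x \<subseteq> ?A"
    by (rule tangent_space_subset_kernel[OF derivf_state]) (use u_mem in \<open>auto simp: fiber_def\<close>)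
  have subL: "tangent_space (level_set \<Lambda> V f h a) (lam, x) \<subseteq> ?B"
  proof -
    have "((h \<circ> snd) has_derivative (H \<circ> snd)) (at (lam, x))"
      using derivh[of x] by (intro diff_chain_at has_derivative_snd has_derivative_ident) (simp add: H_def)
    then have "((\<lambda>w. (f w, h (snd w))) has_derivative (\<lambda>v. (F' v, H (snd v)))) (at (lam, x))"
      by (intro has_derivative_Pair derivf) (simp add: o_def)
    then have "tangent_space (level_set \<Lambda> V f h a) (lam, x) \<subseteq> {v. (F' v, H (snd v)) = 0}"
      by (rule tangent_space_subset_kernel) (use u_mem in \<open>auto simp: level_set_def equilibria_def\<close>)
    then show ?thesis by (auto simp: zero_prod_def)
  qed
  have subspaces: "subspace ?K" "subspace ?A" "subspace ?B"
    using direct split linear_subspace_kernel[OF F'] by (simp_all add: is_direct_sum_def)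

  have "tangent_space E (lam, x) = ?K"
  proof (rule subspace_dim_equal[OF subspace_tangent_space subspaces(1) subE])
    show "dim ?K \<le> dim (tangent_space E (lam, x))"
      using dim_kernel[OF linear_facts] dim_tangent_space_ge E_manifold u_mem(5) by fastforce
  qed
  moreover have "tangent_space (fiber V f lam) x = ?A \<and> tangent_space (level_set \<Lambda> V f h a) (lam, x) = ?B"
  proof (cases "x \<in> frontier V")
    case True
    \<comment> \<open>At a frontier point the sets need not contain all nearby zeros; the dimension count decides.\<close>
    then have bd: "bd_submanifold_at CARD('m) (level_set \<Lambda> V f h a) (lam, x)"
      "bd_submanifold_at CARD('k) (fiber V f lam) x" using boundary_case by auto
    show ?thesis
      using dim_tangent_space_ge[OF bd(1)] dim_tangent_space_ge[OF bd(2)]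
        dim_state_kernel[OF linear_facts] dim_level_kernel[OF linear_facts]
        subspace_dim_equal[OF subspace_tangent_space subspaces(2) subF]
        subspace_dim_equal[OF subspace_tangent_space subspaces(3) subL] by simp
  next
    case False
    then have "x \<in> interior V"
      using u_mem(2) V(1) by (simp add: frontier_def compact_imp_closed)
    have contf: "continuous_on (\<Lambda> \<times> V) f"
      using analytic real_analytic_at_imp_strictly_differentiable strictly_differentiable_imp_has_derivative
        has_derivative_continuous continuous_at_imp_continuous_on by metis
    have eqs: "fiber V f lam = {y \<in> V. f (lam, y) = 0}"
      "level_set \<Lambda> V f h a = {w \<in> \<Lambda> \<times> V. f w = 0 \<and> h (snd w) = h x}"
      using u_mem(4) by (auto simp: fiber_def level_set_def equilibria_def)
    \<comment> \<open>At an interior point the region imposes no constraint, and both sets are full zero sets near \<open>u\<close>.\<close>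
    note cones = kernels_subset_contingent_cones_interior[OF linear_facts Lambda(1) u_mem(1)
        \<open>x \<in> interior V\<close> contf derivf u_mem(3) derivh contDh H_def[symmetric] tangency]
    show ?thesis
      using cones[THEN subspace_subset_contingent_cone_imp_subset_tangent_space] subF subL
      unfolding eqs by blast
  qed
  ultimately show ?thesis using direct by simp
qed

end
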